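(* Let $0\le\alpha\le1$ and let $\mu$ be the Lebesgue measure on the torus $\mathbb{T}^d=\mathbb{R}^d/\mathbb{Z}^d$. For a measurable set $\Omega\subseteq\mathbb{T}^d$ let $$M(\alpha,\Omega)=\sup_{t>0}t^{-\alpha}\mu\left(\{x\in\mathbb{T}^d:\operatorname{dist}(x,\partial\Omega)<t\}\right).$$ Given $\varepsilon>0$, for almost every $x$ in $\mathbb{T}^d$ there exists a constant $c$ such that for every integer $m>1$ and every $\gamma>0$, $$\sup_{M(\alpha,\Omega)<\gamma}\left|\mu(\Omega)-m^{-1}\sum_{j=1}^m\chi_\Omega(jx)\right|\le c\,\gamma\, m^{-\alpha/d}\log^{\alpha(d+1+\varepsilon)/d}(m),$$ where the supremum is over all measurable sets $\Omega\subseteq\mathbb{T}^d$ with $M(\alpha,\Omega)<\gamma$.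
   Context: $\chi_\Omega$ is the characteristic function of $\Omega$, $\partial\Omega$ its topological boundary in the torus, $\operatorname{dist}$ is the distance on $\mathbb{T}^d$ induced by the Euclidean distance on $\mathbb{R}^d$ (with $\operatorname{dist}(x,\emptyset)=+\infty$), and the multiples $jx$ are taken modulo $\mathbb{Z}^d$. The constant $c$ does not depend on $m$, $\gamma$, $\Omega$. *)

theory Defs
  imports "HOL-Analysis.Analysis"
begin

definition int_lattice_rel :: "real^'n \<Rightarrow> real^'n \<Rightarrow> bool" where
  "int_lattice_rel u v \<longleftrightarrow> (\<forall>i. u $ i - v $ i \<in> \<int>)"

lemma equivp_int_lattice_rel: "equivp (int_lattice_rel :: real^'n::finite \<Rightarrow> _)"
proof (rule equivpI)
  show "reflp (int_lattice_rel :: real^'n \<Rightarrow> _)"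
    by (simp add: reflp_def int_lattice_rel_def)
  show "symp (int_lattice_rel :: real^'n \<Rightarrow> _)"
    unfolding symp_def int_lattice_rel_def by (metis Ints_minus minus_diff_eq)
  show "transp (int_lattice_rel :: real^'n \<Rightarrow> _)"
  proof (rule transpI)
    fix u v w :: "real^'n"
    assume "int_lattice_rel u v" "int_lattice_rel v w"
    then have "\<forall>i. (u $ i - v $ i) + (v $ i - w $ i) \<in> \<int>"
      unfolding int_lattice_rel_def by (metis Ints_add)
    then show "int_lattice_rel u w" by (simp add: int_lattice_rel_def)
  qed
qed

text \<open>The torus \<open>\<real>\<^sup>d / \<int>\<^sup>d\<close>, with \<open>d = CARD('n)\<close>.\<close>

quotient_type (overloaded) 'n torus = "real ^ 'n::finite" / int_lattice_rel
  by (rule equivp_int_lattice_rel)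

lift_definition torus_of :: "real^'n \<Rightarrow> 'n::finite torus" is "\<lambda>u. u" .

lift_definition torus_mult :: "nat \<Rightarrow> 'n::finite torus \<Rightarrow> 'n torus" is "\<lambda>j u. real j *\<^sub>R u"
proof -
  fix j and u v :: "real^'n"
  assume "int_lattice_rel u v"
  then have "\<forall>i. real j * (u $ i - v $ i) \<in> \<int>"
    unfolding int_lattice_rel_def by (metis Ints_mult Ints_of_nat)
  then show "int_lattice_rel (real j *\<^sub>R u) (real j *\<^sub>R v)"
    by (simp add: int_lattice_rel_def right_diff_distrib)
qed

lemma torus_of_eq_iff: "torus_of u = torus_of v \<longleftrightarrow> (\<forall>i. u $ i - v $ i \<in> \<int>)"
  by transfer (simp add: int_lattice_rel_def)

lemma torus_of_surj: "\<exists>u. torus_of u = x"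
proof transfer
  fix x :: "real^'n"
  show "\<exists>u. int_lattice_rel u x"
    by (rule exI[of _ x]) (simp add: int_lattice_rel_def)
qed

lemma torus_mult_of: "torus_mult j (torus_of u) = torus_of (real j *\<^sub>R u)"
  by transfer (simp add: int_lattice_rel_def)

text \<open>The quotient distance: the infimum of the Euclidean distances between representatives.\<close>

instantiation torus :: (finite) metric_space
begin

definition dist_torus :: "'a torus \<Rightarrow> 'a torus \<Rightarrow> real" where
  "dist_torus x y = Inf {dist u v | u v. torus_of u = x \<and> torus_of v = y}"

definition uniformity_torus :: "('a torus \<times> 'a torus) filter" where
  "uniformity_torus = (INF e\<in>{0<..}. principal {(x, y). dist x y < e})"

definition open_torus :: "'a torus set \<Rightarrow> bool" where
  "open_torus U \<longleftrightarrow> (\<forall>x\<in>U. eventually (\<lambda>(x', y). x' = x \<longrightarrow> y \<in> U) uniformity)"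

lemma torus_dist_set_bdd: "bdd_below {dist u v | u v. torus_of u = (x::'a torus) \<and> torus_of v = y}"
  by (rule bdd_belowI[of _ 0]) auto

lemma torus_dist_set_ne: "{dist u v | u v. torus_of u = (x::'a torus) \<and> torus_of v = y} \<noteq> {}"
  using torus_of_surj[of x] torus_of_surj[of y] by blast

lemma torus_dist_le: "dist (torus_of u) (torus_of v) \<le> dist u (v::real^'a)"
  unfolding dist_torus_def by (rule cInf_lower[OF _ torus_dist_set_bdd]) blast

lemma torus_dist_approx:
  assumes "e > 0"
  obtains v where "torus_of v = y" "dist u v < dist (torus_of u :: 'a torus) y + e"
proof -
  have "Inf {dist u' v | u' v. torus_of u' = (torus_of u::'a torus) \<and> torus_of v = y}
      < dist (torus_of u) y + e"
    using assms by (simp add: dist_torus_def)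
  then obtain u' v' where *: "torus_of u' = (torus_of u::'a torus)" "torus_of v' = y"
    "dist u' v' < dist (torus_of u) y + e"
    unfolding cInf_less_iff[OF torus_dist_set_ne torus_dist_set_bdd] by blast
  define v where "v = v' + (u - u')"
  have "torus_of v = (torus_of v'::'a torus)"
    using *(1)[symmetric] unfolding torus_of_eq_iff v_def by simp
  moreover have "dist u v = dist u' v'"
    by (simp add: v_def dist_norm algebra_simps)
  ultimately show ?thesis using * that by metis
qed

instance
proof
  show "uniformity = (INF e\<in>{0<..}. principal {(x, y :: 'a torus). dist x y < e})"
    by (rule uniformity_torus_def)
  show "open U \<longleftrightarrow> (\<forall>x\<in>U. eventually (\<lambda>(x', y). x' = x \<longrightarrow> y \<in> U) uniformity)"
    for U :: "'a torus set"
    by (rule open_torus_def)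
  fix x y z :: "'a torus"
  show "dist x y \<le> dist x z + dist y z"
  proof (rule field_le_epsilon)
    fix e :: real assume e: "e > 0"
    obtain w where w: "torus_of w = z" using torus_of_surj by blast
    have sym: "dist a b = dist b a" for a b :: "'a torus"
    proof -
      have "{dist u v | u v. torus_of u = a \<and> torus_of v = b}
          = {dist u v | u v. torus_of u = b \<and> torus_of v = a}"
        by (subst dist_commute) blast
      then show ?thesis by (simp only: dist_torus_def)
    qed
    obtain u where u: "torus_of u = x" "dist w u < dist z x + e/2"
      using torus_dist_approx[of "e/2" x w] e w by auto
    obtain v where v: "torus_of v = y" "dist w v < dist z y + e/2"
      using torus_dist_approx[of "e/2" y w] e w by auto
    have "dist x y \<le> dist u v" using torus_dist_le u(1) v(1) by blast
    also have "\<dots> \<le> dist w u + dist w v" by (rule dist_triangle3)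
    finally show "dist x y \<le> dist x z + dist y z + e"
      using u(2) v(2) sym[of x z] sym[of y z] by linarith
  qed
  show "dist x y = 0 \<longleftrightarrow> x = y"
  proof
    assume "x = y"
    then obtain u where u: "torus_of u = x" "torus_of u = y" using torus_of_surj by blast
    have "dist x y \<le> 0" using torus_dist_le[of u u] u by simp
    moreover have "dist x y \<ge> 0"
      unfolding dist_torus_def by (rule cInf_greatest[OF torus_dist_set_ne]) auto
    ultimately show "dist x y = 0" by simp
  next
    assume d0: "dist x y = 0"
    obtain u where u: "torus_of u = x" using torus_of_surj by blast
    obtain v where v: "torus_of v = y" "dist u v < 1/2"
      using torus_dist_approx[of "1/2" y u] d0 u by auto
    have "dist u v \<le> e" if e: "e > 0" for e
    proof -
      obtain v' where v': "torus_of v' = y" "dist u v' < min e (1/2)"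
        using torus_dist_approx[of "min e (1/2)" y u] d0 u e by auto
      have "dist v v' < 1" using v(2) v'(2) dist_triangle3[of v v' u] by simp
      moreover have "\<bar>v $ i - v' $ i\<bar> \<le> dist v v'" for i
        using component_le_norm_cart[of "v - v'" i] by (simp add: dist_norm)
      ultimately have "\<bar>v $ i - v' $ i\<bar> < 1" for i by (meson le_less_trans)
      moreover have "v $ i - v' $ i \<in> \<int>" for i
        using v(1) v'(1) torus_of_eq_iff by metis
      ultimately have "v $ i - v' $ i = 0" for i
        using Ints_nonzero_abs_less1 by blast
      then have "v = v'" by (simp add: vec_eq_iff)
      then show ?thesis using v'(2) by simp
    qed
    from this[of "dist u v / 2"] have "dist u v = 0"
      by (cases "dist u v = 0") simp_all
    then show "x = y" using u v(1) by simp
  qed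
qed

end

text \<open>Lebesgue measure on the torus: the completion of the image, under the quotient map, of the
  Borel--Lebesgue measure on the fundamental domain \<open>[0,1)\<^sup>d\<close>.\<close>

definition unit_cell :: "(real^'n) set" where
  "unit_cell = {u. \<forall>i. u $ i \<in> {0..<1}}"

definition torus_measure :: "'n::finite torus measure" where
  "torus_measure = completion (distr (restrict_space lborel unit_cell) borel torus_of)"

text \<open>Extended-real valued, so that the distance to the empty set is \<open>\<infinity>\<close>
  (unlike \<^const>\<open>infdist\<close>).\<close>

definition edist_set :: "'a::metric_space \<Rightarrow> 'a set \<Rightarrow> ereal" where
  "edist_set x A = (INF y\<in>A. ereal (dist x y))"

definition boundary_content :: "real \<Rightarrow> 'n::finite torus set \<Rightarrow> ennreal" where
  "boundary_content \<alpha> \<Omega> =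
     (SUP t\<in>{0<..}. ennreal (t powr (- \<alpha>)) *
        emeasure torus_measure {x. edist_set x (frontier \<Omega>) < ereal t})"

text \<open>The remaining facts confirm that the torus carries the quotient topology, that the map
  pushed forward above is measurable, and that the resulting measure has total mass 1.\<close>

lemma continuous_on_torus_of: "continuous_on S (torus_of :: real^'n::finite \<Rightarrow> _)"
  unfolding continuous_on_iff by (meson torus_dist_le le_less_trans)

lemma open_torus_iff: "open U \<longleftrightarrow> open (torus_of -` U)" for U :: "'n::finite torus set"
proof
  assume "open U"
  then show "open (torus_of -` U)"
    by (rule open_vimage[OF _ continuous_on_torus_of])
next
  assume op: "open (torus_of -` U)"
  show "open U"
    unfolding open_dist
  proof
    fix x assume "x \<in> U"
    obtain u where u: "torus_of u = x" using torus_of_surj by blast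
    then obtain e where e: "e > 0" "\<And>v. dist v u < e \<Longrightarrow> torus_of v \<in> U"
      using op \<open>x \<in> U\<close> unfolding open_dist by auto
    have "y \<in> U" if "dist y x < e" for y
    proof -
      have pos: "e - dist x y > 0" using that by (simp add: dist_commute)
      obtain v where "torus_of v = y" "dist u v < dist x y + (e - dist x y)"
        using torus_dist_approx[OF pos, of y u] u by blast
      then show ?thesis using e(2)[of v] by (simp add: dist_commute)
    qed
    then show "\<exists>e>0. \<forall>y. dist y x < e \<longrightarrow> y \<in> U" using e(1) by blast
  qed
qed

lemma torus_of_measurable:
  "torus_of \<in> measurable (restrict_space lborel unit_cell) (borel :: 'n::finite torus measure)"
proof -
  have "torus_of \<in> borel_measurable (borel :: (real^'n) measure)"
    by (rule borel_measurable_continuous_onI[OF continuous_on_torus_of])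
  then have "torus_of \<in> borel_measurable (lborel :: (real^'n) measure)" by simp
  then show ?thesis by (rule measurable_restrict_space1)
qed

lemma unit_cell_measurable: "unit_cell \<in> sets (borel :: (real^'n::finite) measure)"
proof -
  have "unit_cell = (\<Inter>i. {u::real^'n. 0 \<le> u $ i} \<inter> {u. u $ i < 1})"
    by (auto simp: unit_cell_def)
  also have "\<dots> \<in> sets borel"
    by (intro sets.countable_INT' sets.Int borel_closed borel_open
        closed_Collect_le open_Collect_less continuous_intros) (auto simp: countable_finite)
  finally show ?thesis .
qed

lemma space_torus_measure: "space torus_measure = UNIV"
  by (simp add: torus_measure_def)

lemma emeasure_torus_measure_UNIV: "emeasure (torus_measure :: 'n::finite torus measure) UNIV = 1"
proof -
  have "emeasure lborel (unit_cell :: (real^'n) set) = 1"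
  proof (rule antisym)
    have 1: "emeasure lborel (cbox 0 (1::real^'n)) = 1" "emeasure lborel (box 0 (1::real^'n)) = 1"
      by (auto simp: emeasure_lborel_cbox_eq emeasure_lborel_box_eq Basis_vec_def
          inner_axis intro!: prod.neutral)
    have "unit_cell \<subseteq> cbox 0 (1::real^'n)" "box 0 (1::real^'n) \<subseteq> unit_cell"
      by (auto simp: unit_cell_def mem_box_cart less_imp_le)
    then show "emeasure lborel (unit_cell :: (real^'n) set) \<le> 1"
      "1 \<le> emeasure lborel (unit_cell :: (real^'n) set)"
      using 1 emeasure_mono[of "unit_cell" "cbox 0 (1::real^'n)" lborel]
        emeasure_mono[of "box 0 (1::real^'n)" unit_cell lborel] unit_cell_measurable by auto
  qed
  moreover have "emeasure (distr (restrict_space lborel unit_cell) borel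
        (torus_of :: real^'n \<Rightarrow> _)) UNIV
      = emeasure (restrict_space lborel unit_cell) (unit_cell :: (real^'n) set)"
    by (subst emeasure_distr[OF torus_of_measurable]) (simp_all add: space_restrict_space)
  moreover have "\<dots> = emeasure lborel (unit_cell :: (real^'n) set)"
    by (simp add: emeasure_restrict_space unit_cell_measurable)
  ultimately show ?thesis by (simp add: torus_measure_def)
qed

end

theory Submission
  imports Defs "HOL-Number_Theory.Cong"
begin

text \<open>
  Write \<open>E(m)\<close> for the largest value of \<open>|#{j \<le> m. j x \<in> B} - m vol B|\<close> over boxes
  \<open>B \<subseteq> [0,1)\<^sup>d\<close>. For almost every \<open>x\<close> it is \<open>O(log\<^bsup>d+1+\<epsilon>\<^esup> m)\<close>, for the following reason. Round
  \<open>x\<close> down to a point \<open>p / N\<close> of the grid of mesh \<open>1 / N\<close>, where \<open>N \<ge> m\<^sup>2\<close> is prime; this moves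
  the first \<open>m\<close> multiples by less than \<open>m / N \<le> 1 / m\<close>, so it suffices to count the \<open>j p\<close> in boxes
  of \<open>(\<int>/N)\<^sup>d\<close>. Expanding the indicator of such a box into characters and summing geometric
  progressions bounds the error by a sum over the frequencies \<open>k \<noteq> 0\<close> of
  \<open>\<Prod>\<^sub>i 1 / |k\<^sub>i| \<cdot> 1 / \<parallel>k \<cdot> p / N\<parallel>\<close>, whose mean over \<open>p\<close> is \<open>O(log\<^bsup>d+1\<^esup> N)\<close> because \<open>k \<cdot> p\<close> is
  equidistributed mod \<open>N\<close>. Markov's inequality and the Borel--Cantelli lemma along scales
  \<open>N \<approx> 2^(2^l)\<close> finish the argument: these scales are so sparse that \<open>\<Sum>\<^sub>l (log N)\<^bsup>-\<epsilon>\<^esup>\<close> converges,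
  and yet every \<open>m\<close> has a scale with \<open>log N = O(log m)\<close>.

  To pass from boxes to \<open>\<Omega>\<close>, cut the torus into \<open>K\<^sup>d\<close> cubes of side \<open>1 / K\<close> and sum by parts along
  the lines of cubes in one direction. The error \<open>E(m)\<close> is then paid only twice per line and once
  for each change between cubes that meet \<open>\<Omega>\<close> and cubes that do not; each change takes place within
  \<open>O(1 / K)\<close> of the boundary, so there are \<open>O(\<gamma> K\<^bsup>d-\<alpha>\<^esup>)\<close> of them. Taking \<open>K\<^sup>d \<approx> m / E(m)\<close> yields
  \<open>O(\<gamma> (E(m) / m)\<^bsup>\<alpha>/d\<^esup>)\<close>.
\<close>

section \<open>Primes between \<open>n\<close> and \<open>2 n\<^sup>2\<close>\<close>

text \<open>Multiply Leibniz's recursion \<open>1 / (k C(n,k)) = 1 / (k C(n-1,k)) - 1 / ((k+1) C(n,k+1))\<close>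
  by \<open>L\<close>.\<close>

lemma times_binomial_dvd:
  fixes L :: nat
  assumes L: "\<And>i. 1 \<le> i \<Longrightarrow> i \<le> N \<Longrightarrow> i dvd L" and "1 \<le> k" "k \<le> n" "n \<le> N"
  shows "k * (n choose k) dvd L"
proof -
  have "real L / (real k * real (n choose k)) \<in> \<int>"
    using assms(2-4)
  \<comment> \<open>The two terms of the recursion, at \<open>(n - 1, k)\<close> and
    \<open>(n, k + 1)\<close>, both have a smaller \<open>n - k\<close>; for \<open>n = k\<close>
    the claim is the hypothesis on \<open>L\<close>.\<close>
  proof (induction "n - k" arbitrary: n k)
    case 0
    then have "n = k" by simp
    with 0 L[of k] obtain q where "L = k * q" by (auto simp: dvd_def)
    with 0 \<open>n = k\<close> show ?case by simp
  next
    case (Suc d)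
    then have kn: "k < n" by simp
    obtain n' where n: "n = Suc n'" using kn by (cases n) auto
    have "d = n' - k" "1 \<le> k" "k \<le> n'" "n' \<le> N" using Suc kn n by auto
    then have 1: "real L / (real k * real (n' choose k)) \<in> \<int>" by (rule Suc)
    have "d = n - Suc k" "1 \<le> Suc k" "Suc k \<le> n" "n \<le> N" using Suc kn n by auto
    then have 2: "real L / (real (Suc k) * real (n choose Suc k)) \<in> \<int>" by (rule Suc)
    have a: "real (Suc k) * real (n choose Suc k) = real n * real (n' choose k)"
      unfolding n of_nat_mult[symmetric] by (simp only: Suc_times_binomial mult.commute)
    have b: "real (n - k) * real (n choose k) = real n * real (n' choose k)"
      using binomial_absorb_comp[of n k] unfolding n of_nat_mult[symmetric] by simp
    define c where "c = real (n' choose k)"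
    have c: "c > 0" using \<open>k \<le> n'\<close> by (simp add: c_def)
    have nk: "real (n - k) > 0" "real n > 0" "real k > 0" using kn Suc by auto
    have e: "real (n choose k) = real n * c / real (n - k)"
      using b nk unfolding c_def by (simp add: field_simps)
    have "1 / (real k * real (n choose k)) = 1 / (real k * c) - 1 / (real n * c)"
      unfolding e using nk c kn by (simp add: field_simps of_nat_diff)
    then have "real L / (real k * real (n choose k))
        = real L / (real k * c) - real L / (real n * c)"
      by (metis (no_types, lifting) mult.right_neutral right_diff_distrib times_divide_eq_right)
    with 1 2 show ?case unfolding a c_def by simp
  qed
  then obtain z :: int where z: "real L / (real k * real (n choose k)) = of_int z"
    by (auto elim: Ints_cases)
  have "real L = of_int z * (real k * real (n choose k))"
    using z assms by (simp add: field_simps)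
  then have "int L = z * (int k * int (n choose k))"
    by (metis (mono_tags, lifting) of_int_eq_iff of_int_mult of_int_of_nat_eq)
  then have "int (k * (n choose k)) dvd int L" by simp
  then show ?thesis by (simp only: int_dvd_int_iff)
qed

text \<open>Chebyshev's argument: the product \<open>L\<close> of the largest prime powers up to
  \<open>n\<close> is the least common multiple of 1, ..., n. It is a multiple of
  \<open>k * (n choose k)\<close>, and each of its factors is at most \<open>n\<close>.\<close>

lemma binomial_le_power_card_primes:
  assumes "1 \<le> k" "k \<le> n"
  shows "n choose k \<le> n ^ card {p::nat. prime p \<and> p \<le> n}"
proof -
  define P where "P = {p::nat. prime p \<and> p \<le> n}"
  define e where "e p = Max {e. p ^ e \<le> n}" for p :: nat
  define L where "L = (\<Prod>p\<in>P. p ^ e p)"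
  have finP: "finite P" unfolding P_def by simp
  have fin: "finite {e. p ^ e \<le> n}" if "prime p" for p :: nat
  proof (rule finite_subset)
    show "{e. p ^ e \<le> n} \<subseteq> {..n}"
      using that prime_gt_1_nat power_gt_expt[of p]
      by (auto intro: order.strict_implies_order less_le_trans)
  qed simp
  have ne: "{e. p ^ e \<le> n} \<noteq> {}" for p :: nat
    using assms by (auto intro: exI[of _ 0])
  have pe: "p ^ e p \<le> n" if "prime p" for p :: nat
    using Max_in[OF fin[OF that] ne] unfolding e_def by simp
  have dvdL: "i dvd L" if i: "1 \<le> i" "i \<le> n" for i
  proof -
    have "i = (\<Prod>p\<in>prime_factors i. p ^ multiplicity p i)"
      using i by (simp add: prime_factorization_nat)
    also have "\<dots> dvd L" unfolding L_def
    proof (rule prod_dvd_prod_subset2[OF finP])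
      show "prime_factors i \<subseteq> P"
        using i by (auto simp: P_def in_prime_factors_iff intro: order_trans[OF dvd_imp_le])
      show "p ^ multiplicity p i dvd p ^ e p" if p: "p \<in> prime_factors i" for p
      proof (rule le_imp_power_dvd)
        have pp: "prime p" using p by auto
        have "p ^ multiplicity p i \<le> n"
          using i dvd_imp_le[OF multiplicity_dvd[of p i]] by linarith
        then show "multiplicity p i \<le> e p"
          unfolding e_def by (intro Max_ge fin pp) simp
      qed
    qed
    finally show ?thesis .
  qed
  have "L > 0" unfolding L_def by (auto intro!: prod_pos simp: P_def prime_gt_0_nat)
  have "n choose k \<le> k * (n choose k)" using assms by simp
  also have "\<dots> \<le> L"
    using times_binomial_dvd[of n L k n] dvdL assms \<open>L > 0\<close> by (intro dvd_imp_le) auto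
  also have "\<dots> \<le> (\<Prod>p\<in>P. n)"
    unfolding L_def by (intro prod_mono) (auto simp: P_def pe)
  also have "\<dots> = n ^ card P" by simp
  finally show ?thesis unfolding P_def .
qed

text \<open>Otherwise all primes up to \<open>2 * n\<^sup>2\<close> would be at most
  \<open>n\<close>, too few for the central binomial coefficient to be as large as it is. The
  generous upper end is harmless: the estimates from above see the prime only through its logarithm,
  which changes by a bounded factor.\<close>

lemma exists_prime_le_square:
  fixes n :: nat
  assumes n: "n \<ge> 4"
  shows "\<exists>p. prime p \<and> n < p \<and> p \<le> 2 * n\<^sup>2"
proof (rule ccontr)
  assume no: "\<not> ?thesis"
  define M where "M = n\<^sup>2"
  have M0: "M > 0" using n by (simp add: M_def)
  have "{p::nat. prime p \<and> p \<le> 2 * M} \<subseteq> {1..n}"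
  proof
    fix p assume p: "p \<in> {p::nat. prime p \<and> p \<le> 2 * M}"
    then have "p \<le> n" using no by (auto simp: M_def not_less)
    with p show "p \<in> {1..n}" using prime_ge_1_nat by auto
  qed
  from card_mono[OF _ this] have c: "card {p::nat. prime p \<and> p \<le> 2 * M} \<le> n" by simp
  have "real ((2 * M) choose M) \<le> real ((2 * M) ^ card {p::nat. prime p \<and> p \<le> 2 * M})"
    using M0 by (intro of_nat_mono binomial_le_power_card_primes) auto
  also have "\<dots> \<le> real ((2 * M) ^ n)"
    using M0 c by (intro of_nat_mono power_increasing) auto
  finally have b: "real ((2 * M) choose M) \<le> real (2 * M) ^ n" by simp
  have "4 ^ M / (2 * real M) \<le> real ((2 * M) choose M)"
    by (rule central_binomial_lower_bound[OF M0])
  with b have "4 ^ M / (2 * real M) \<le> (2 * real M) ^ n" by simp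
  then have "4 ^ M \<le> (2 * real M) ^ Suc n" using M0 by (simp add: field_simps)
  then have up: "(4::nat) ^ M \<le> (2 * M) ^ Suc n"
    by (metis (mono_tags, opaque_lifting) of_nat_le_iff of_nat_mult of_nat_numeral of_nat_power)
  \<comment> \<open>The exponent \<open>n - 1\<close> is chosen so that
    \<open>(n - 1) * Suc n\<close> does not exceed \<open>M = n\<^sup>2\<close>.\<close>
  have "2 * M < (4::nat) ^ (n - 1)"
    using n unfolding M_def
  proof (induction n rule: nat_induct_at_least)
    case (Suc n)
    have "2 * (Suc n)\<^sup>2 \<le> 4 * (2 * n\<^sup>2)"
    proof -
      have "4 * n \<le> n * n" using Suc(1) by simp
      with Suc(1) have "2 * (n * n) + 4 * n + 2 \<le> 8 * (n * n)" by linarith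
      then show ?thesis by (simp add: power2_eq_square algebra_simps)
    qed
    also have "\<dots> < 4 * 4 ^ (n - 1)" using Suc by simp
    also have "\<dots> = 4 ^ (Suc n - 1)" using Suc(1) by (cases n) auto
    finally show ?case .
  qed (simp add: eval_nat_numeral)
  then have "(2 * M) ^ Suc n < ((4::nat) ^ (n - 1)) ^ Suc n"
    by (rule power_strict_mono) auto
  also have "\<dots> = 4 ^ ((n - 1) * Suc n)" by (simp only: power_mult)
  also have "\<dots> \<le> 4 ^ M"
  proof (rule power_increasing)
    show "(n - 1) * Suc n \<le> M"
      unfolding M_def power2_eq_square by (cases n) auto
  qed simp
  finally show False using up by simp
qed

section \<open>Counting with characters of \<open>\<int>/N\<close>\<close>

text \<open>Up to a constant \<open>1 / (N \<parallel>r / N\<parallel>)\<close>, with \<open>\<parallel>\<cdot>\<parallel>\<close> the distance to the nearest integer. The value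
  at \<open>0\<close> is \<open>2\<close> because the enlarged boxes may have sides slightly longer than \<open>1\<close>.\<close>

definition wt :: "nat \<Rightarrow> nat \<Rightarrow> real" where
  "wt N r = (if r = 0 then 2 else (1 / real r + 1 / real (N - r)))"

lemma wt_nonneg: "wt N r \<ge> 0"
  by (simp add: wt_def)

lemma sum_wt_le:
  assumes "N \<ge> 1"
  shows "(\<Sum>r<N. wt N r) \<le> 4 + 2 * ln (real N)"
proof (cases "N = 1")
  case False
  then have N: "N \<ge> 2" using assms by simp
  have "{..<N} = insert 0 {1..<N}" using N by auto
  then have "(\<Sum>r<N. wt N r) = 2 + (\<Sum>r=1..<N. (1 / real r + 1 / real (N - r)))"
    by (simp add: wt_def)
  also have "(\<Sum>r=1..<N. (1 / real r + 1 / real (N - r)))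
      = (\<Sum>r=1..<N. 1 / real r) + (\<Sum>r=1..<N. 1 / real (N - r))"
    by (simp only: sum.distrib)
  also have "(\<Sum>r=1..<N. 1 / real (N - r)) = (\<Sum>r=1..<N. 1 / real r)"
    by (rule sum.reindex_bij_witness[of _ "\<lambda>r. N - r" "\<lambda>r. N - r"]) auto
  also have "(\<Sum>r=1..<N. 1 / real r) = harm (N - 1)"
    unfolding harm_def by (rule sum.cong) (use N in \<open>auto simp: divide_simps\<close>)
  also have "harm (N - 1) \<le> 1 + ln (real N)"
  proof -
    have "harm (N - 1) - ln (real (N - 1)) \<le> harm 1 - ln (real 1)"
      using N by (intro euler_mascheroni_sequence_decreasing) auto
    moreover have "ln (real (N - 1)) \<le> ln (real N)" using N by simp
    ultimately show ?thesis by (simp add: harm_def)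
  qed
  finally show ?thesis by simp
qed (simp add: wt_def)


text \<open>The shape \<open>t * (1 - t)\<close> is chosen because its reciprocal at
  \<open>t = q / N\<close> is exactly \<open>N * wt N q\<close>. Up to 1/2 the bound follows from
  the Maclaurin polynomial with cubic remainder and the crude estimates of pi by 2 and 4; the rest
  is the symmetry \<open>t\<close> to \<open>1 - t\<close>.\<close>

lemma sin_pi_ge:
  assumes "0 < t" "t < 1"
  shows "t * (1 - t) \<le> sin (pi * t)"
proof -
  have *: "x * (1 - x) \<le> sin (pi * x)" if x: "0 < x" "x \<le> 1 / 2" for x
  proof -
    define y where "y = pi * x"
    have y: "0 < y" "y \<le> 2" "x \<le> y / 2" "y / 4 \<le> x"
      using x pi_less_4 pi_ge_two mult_mono[of pi 4 x "1 / 2"] mult_right_mono[of pi 4 x]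
        mult_right_mono[of 2 pi x]
      by (auto simp: y_def)
    have "\<bar>sin y - (\<Sum>m<3. sin_coeff m * y ^ m)\<bar> \<le> inverse (fact 3) * \<bar>y\<bar> ^ 3"
      by (rule Maclaurin_sin_bound)
    then have "\<bar>sin y - y\<bar> \<le> y ^ 3 / 6"
      using y by (simp add: eval_nat_numeral sin_coeff_def)
    moreover have "y ^ 3 \<le> 2 * y\<^sup>2"
      using mult_right_mono[OF y(2), of "y\<^sup>2"] by (simp add: eval_nat_numeral)
    moreover have "y\<^sup>2 \<le> 2 * y"
      using mult_right_mono[OF y(2), of y] y(1) by (simp add: power2_eq_square)
    moreover have "x * (1 - x) \<le> y / 2 * (1 - y / 4)"
      using x y by (intro mult_mono) auto
    then have "x * (1 - x) \<le> y / 2 - y\<^sup>2 / 8"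
      by (simp add: power2_eq_square field_simps)
    ultimately have "x * (1 - x) \<le> sin y" using y(1) by linarith
    then show ?thesis by (simp add: y_def)
  qed
  show ?thesis
  proof (cases "t \<le> 1 / 2")
    case False
    have "sin (pi * t) = sin (pi * (1 - t))"
      by (simp add: algebra_simps sin_diff)
    with *[of "1 - t"] False assms show ?thesis by (simp add: mult.commute)
  qed (use * assms in auto)
qed

lemma norm_one_minus_cis: "norm (1 - cis x) = 2 * \<bar>sin (x / 2)\<bar>"
proof (rule power2_eq_imp_eq)
  have c: "cos x = 1 - 2 * (sin (x / 2))\<^sup>2"
    using cos_double_sin[of "x / 2"] by simp
  have "(norm (1 - cis x))\<^sup>2 = (1 - cos x)\<^sup>2 + (sin x)\<^sup>2"
    by (simp add: cmod_power2)
  also have "\<dots> = 2 - 2 * cos x"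
    using sin_cos_squared_add[of x] by (simp add: power2_diff)
  finally show "(norm (1 - cis x))\<^sup>2 = (2 * \<bar>sin (x / 2)\<bar>)\<^sup>2"
    using c by (simp add: power_mult_distrib)
qed auto

text \<open>A geometric progression with ratio \<open>z\<close>: the numerator is at most 2 whatever
  the number of terms, and the denominator is \<open>2 * sin (pi * q / N)\<close>.\<close>

lemma norm_sum_cis_le:
  fixes s t r :: int
  assumes r: "r mod int N \<noteq> 0" and N: "N > 0"
  shows "norm (\<Sum>j\<in>{s..<t}. cis (2 * pi * real_of_int (j * r) / real N))
    \<le> real N * wt N (nat (r mod int N))"
proof -
  define q where "q = nat (r mod int N)"
  have q: "q \<noteq> 0" "q < N" "int q = r mod int N"
    using r N pos_mod_sign[of "int N" r] pos_mod_bound[of "int N" r]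
    by (auto simp: q_def nat_less_iff order_le_less simp del: pos_mod_sign pos_mod_bound)
  define x where "x = 2 * pi * real q / real N"
  define z where "z = cis x"
  have per: "cis (2 * pi * real_of_int (j * r) / real N) = z powi j" for j
  proof -
    have "r = int q + int N * (r div int N)" using q(3) by simp
    then have "real_of_int r = real q + real N * real_of_int (r div int N)"
      by (metis of_int_add of_int_mult of_int_of_nat_eq)
    then have "2 * pi * real_of_int (j * r) / real N
        = real_of_int j * x + 2 * pi * real_of_int (j * (r div int N))"
      using N by (simp add: x_def field_simps)
    moreover have "cis (2 * pi * real_of_int (j * (r div int N))) = 1"
      by (rule cis_multiple_2pi) simp
    ultimately have "cis (2 * pi * real_of_int (j * r) / real N) = cis (real_of_int j * x)"
      by (simp only: cis_mult[symmetric] mult_1_right)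
    then show ?thesis by (simp add: z_def cis_power_int)
  qed
  have z1: "norm (1 - z) = 2 * sin (pi * (real q / real N))" and s0: "sin (pi * (real q / real N)) > 0"
  proof -
    have "norm (1 - z) = 2 * \<bar>sin (x / 2)\<bar>"
      unfolding z_def by (rule norm_one_minus_cis)
    moreover show "sin (pi * (real q / real N)) > 0"
      using q by (intro sin_gt_zero) (auto simp: field_simps)
    ultimately show "norm (1 - z) = 2 * sin (pi * (real q / real N))"
      by (simp add: x_def field_simps)
  qed
  then have zne: "z \<noteq> 1" by auto
  have z0: "z \<noteq> 0" "norm z = 1" by (simp_all add: z_def)
  define n where "n = nat (t - s)"
  have "(\<Sum>j\<in>{s..<t}. z powi j) = (\<Sum>i<n. z powi s * z ^ i)"
    by (rule sum.reindex_bij_witness[of _ "\<lambda>i. s + int i" "\<lambda>j. nat (j - s)"])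
      (auto simp: n_def z0 simp flip: power_int_of_nat power_int_add)
  also have "\<dots> = z powi s * ((1 - z ^ n) / (1 - z))"
    using zne by (simp add: sum_distrib_left[symmetric] sum_gp_strict)
  also have "norm \<dots> = norm (1 - z ^ n) / norm (1 - z)"
    using z0 by (simp add: norm_mult norm_divide norm_power_int)
  also have "\<dots> \<le> 2 / norm (1 - z)"
    using norm_triangle_ineq4[of 1 "z ^ n"] z0 by (intro divide_right_mono) (auto simp: norm_power)
  also have "\<dots> = 1 / sin (pi * (real q / real N))"
    using z1 by simp
  also have "\<dots> \<le> 1 / (real q / real N * (1 - real q / real N))"
    using q by (intro divide_left_mono sin_pi_ge mult_pos_pos s0) (auto simp: field_simps)
  also have "\<dots> = real N * wt N q"
    using q by (simp add: wt_def field_simps of_nat_diff)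
  finally show ?thesis using per by (simp add: q_def)
qed

lemma wt_sym: "0 < k \<Longrightarrow> k < N \<Longrightarrow> wt N (N - k) = wt N k"
  by (simp add: wt_def)

lemma sum_cis_orthogonal:
  fixes a :: int
  assumes N: "N > 0"
  shows "(\<Sum>k<N. cis (2 * pi * real_of_int (int k * a) / real N))
    = (if int N dvd a then of_nat N else 0)"
proof -
  define x where "x = 2 * pi * real_of_int a / real N"
  have pow: "cis (2 * pi * real_of_int (int k * a) / real N) = cis x ^ k" for k
    unfolding x_def Complex.DeMoivre by (rule arg_cong[of _ _ cis]) simp
  have one: "cis x = 1 \<longleftrightarrow> int N dvd a"
  proof -
    have "cis x = 1 \<longleftrightarrow> norm (1 - cis x) = 0" by auto
    also have "\<dots> \<longleftrightarrow> sin (real_of_int a / real N * pi) = 0"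
      by (simp add: norm_one_minus_cis x_def mult.commute)
    also have "\<dots> \<longleftrightarrow> real_of_int a / real N \<in> \<int>"
      by (rule sin_times_pi_eq_0)
    also have "\<dots> \<longleftrightarrow> int N dvd a"
    proof
      assume "real_of_int a / real N \<in> \<int>"
      then obtain z where "real_of_int a / real N = of_int z" by (auto elim: Ints_cases)
      then have "real_of_int a = of_int z * real N" using N by (simp add: field_simps)
      then have "a = z * int N" by (metis of_int_eq_iff of_int_mult of_int_of_nat_eq)
      then show "int N dvd a" by simp
    qed (use N in \<open>auto simp: dvd_def\<close>)
    finally show ?thesis .
  qed
  have "cis x ^ N = 1"
  proof -
    have "cis x ^ N = cis (2 * pi * real_of_int a)"
      unfolding x_def Complex.DeMoivre using N by (intro arg_cong[of _ _ cis]) simp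
    also have "\<dots> = 1" by (rule cis_multiple_2pi) simp
    finally show ?thesis .
  qed
  then show ?thesis
    unfolding pow using one by (auto simp: sum_gp_strict)
qed

text \<open>A count instead of an indicator, since a window longer than \<open>N\<close> meets a
  residue class several times; the Fourier expansion then holds for every window.\<close>

definition residue_count :: "nat \<Rightarrow> int \<Rightarrow> int \<Rightarrow> int \<Rightarrow> nat" where
  "residue_count N s t q = card {z \<in> {s..<t}. int N dvd q - z}"

text \<open>The Fourier coefficient on \<open>\<int>/N\<close> of the periodised indicator of
  \<open>{s..<t}\<close>.\<close>

definition interval_coeff :: "nat \<Rightarrow> int \<Rightarrow> int \<Rightarrow> nat \<Rightarrow> complex" where
  "interval_coeff N s t k
    = (\<Sum>z\<in>{s..<t}. cis (2 * pi * real_of_int (z * - int k) / real N)) / of_nat N"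

lemma residue_count_fourier:
  assumes N: "N > 0"
  shows "of_nat (residue_count N s t q)
    = (\<Sum>k<N. interval_coeff N s t k * cis (2 * pi * real_of_int (int k * q) / real N))"
proof -
  have "(\<Sum>k<N. interval_coeff N s t k * cis (2 * pi * real_of_int (int k * q) / real N))
      = (\<Sum>k<N. \<Sum>z\<in>{s..<t}. cis (2 * pi * real_of_int (int k * (q - z)) / real N) / of_nat N)"
    unfolding interval_coeff_def sum_divide_distrib sum_distrib_right
    by (intro sum.cong refl)
      (simp add: cis_mult algebra_simps add_divide_distrib[symmetric] diff_divide_distrib[symmetric])
  also have "\<dots> = (\<Sum>z\<in>{s..<t}. \<Sum>k<N. cis (2 * pi * real_of_int (int k * (q - z)) / real N) / of_nat N)"
    by (rule sum.swap)
  also have "\<dots> = (\<Sum>z\<in>{s..<t}. if int N dvd q - z then 1 else 0)"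
    by (intro sum.cong refl, subst sum_divide_distrib[symmetric], subst sum_cis_orthogonal[OF N])
      (use N in auto)
  also have "\<dots> = of_nat (residue_count N s t q)"
    by (simp add: residue_count_def sum.If_cases Int_def)
  finally show ?thesis by simp
qed

lemma interval_coeff_0: "s \<le> t \<Longrightarrow> interval_coeff N s t 0 = of_real (real_of_int (t - s) / real N)"
  by (simp add: interval_coeff_def)

lemma norm_interval_coeff_le:
  assumes k: "k < N" and st: "s \<le> t" "t - s \<le> 2 * int N"
  shows "norm (interval_coeff N s t k) \<le> wt N k"
proof (cases "k = 0")
  case True
  have "real_of_int (t - s) \<le> real_of_int (2 * int N)"
    using st by (simp only: of_int_le_iff)
  then have "real_of_int (t - s) / real N \<le> 2"
    using k by (simp add: field_simps)
  moreover have "real_of_int (t - s) / real N \<ge> 0" using st by simp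
  ultimately show ?thesis
    unfolding True interval_coeff_0[OF st(1)] norm_of_real by (simp add: wt_def)
next
  case False
  have m: "(- int k) mod int N = int (N - k)"
    using False k by (simp add: zmod_zminus1_eq_if of_nat_diff)
  have "norm (interval_coeff N s t k)
      = norm (\<Sum>z\<in>{s..<t}. cis (2 * pi * real_of_int (z * - int k) / real N)) / real N"
    by (simp add: interval_coeff_def norm_divide)
  also have "\<dots> \<le> (real N * wt N (nat ((- int k) mod int N))) / real N"
    using False k m by (intro divide_right_mono norm_sum_cis_le) auto
  also have "\<dots> = wt N k"
    using False k unfolding m nat_int by (simp add: wt_sym)
  finally show ?thesis .
qed

text \<open>The frequencies \<open>k\<close> are represented by \<open>0 \<le> k i < N\<close>.\<close>

definition resonance :: "nat \<Rightarrow> ('n::finite \<Rightarrow> nat) \<Rightarrow> real" where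
  "resonance N p = (\<Sum>k\<in>{k. (\<forall>i. k i < N) \<and> (\<exists>i. k i \<noteq> 0)}.
     (\<Prod>i\<in>UNIV. wt N (k i)) * (real N * wt N ((\<Sum>i\<in>UNIV. k i * p i) mod N)))"

section \<open>Sums over frequencies and their mean over the grid points\<close>

lemma PiE_UNIV_lessThan: "PiE UNIV (\<lambda>_. {..<N}) = {k :: 'n \<Rightarrow> nat. \<forall>i. k i < N}"
  by (auto simp: PiE_def extensional_def)

lemma finite_bounded_funs: "finite {k :: 'n::finite \<Rightarrow> nat. \<forall>i. k i < N}"
  unfolding PiE_UNIV_lessThan[symmetric] by (rule finite_PiE) auto

lemma card_bounded_funs: "card {k :: 'n::finite \<Rightarrow> nat. \<forall>i. k i < N} = N ^ CARD('n)"
  unfolding PiE_UNIV_lessThan[symmetric] by (simp add: card_PiE)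

text \<open>After multiplying out the one-dimensional expansions, frequency 0 produces the expected
  count. For every other \<open>k\<close> the coefficient is at most the product of the weights, and
  the sum over \<open>j\<close> is geometric with residue \<open>k . p\<close>.\<close>

lemma sum_residue_count_le_resonance:
  fixes s t :: "'n::finite \<Rightarrow> int" and p :: "'n \<Rightarrow> nat"
  assumes N: "N > 0" and m: "m \<le> 2 * N"
    and st: "\<And>i. s i \<le> t i" "\<And>i. t i - s i \<le> 2 * int N"
  shows "\<bar>(\<Sum>j=1..m. \<Prod>i\<in>UNIV. real (residue_count N (s i) (t i) (int j * int (p i))))
      - real m * (\<Prod>i\<in>UNIV. real_of_int (t i - s i) / real N)\<bar> \<le> resonance N p"
proof -
  define P where "P = {k :: 'n \<Rightarrow> nat. \<forall>i. k i < N}"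
  define P' where "P' = {k :: 'n \<Rightarrow> nat. (\<forall>i. k i < N) \<and> (\<exists>i. k i \<noteq> 0)}"
  have P: "P = insert (\<lambda>_. 0) P'" "(\<lambda>_. 0) \<notin> P'" "finite P'"
    using N finite_subset[OF _ finite_bounded_funs[of N], of P'] by (auto simp: P_def P'_def fun_eq_iff)
  define C where "C k = (\<Prod>i\<in>UNIV. interval_coeff N (s i) (t i) (k i))" for k
  define S where "S k = (\<Sum>i\<in>UNIV. k i * p i)" for k
  define E where "E k = (\<Sum>j=1..m. cis (2 * pi * real_of_int (int j * int (S k)) / real N))" for k
  have expand: "of_nat (\<Prod>i\<in>UNIV. residue_count N (s i) (t i) (int j * int (p i)))
      = (\<Sum>k\<in>P. C k * cis (2 * pi * real_of_int (int j * int (S k)) / real N))" for j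
  proof -
    have "of_nat (\<Prod>i\<in>UNIV. residue_count N (s i) (t i) (int j * int (p i)))
       = (\<Prod>i\<in>UNIV. \<Sum>k<N. interval_coeff N (s i) (t i) k
            * cis (2 * pi * real_of_int (int k * (int j * int (p i))) / real N))"
      using N by (simp add: residue_count_fourier)
    also have "\<dots> = (\<Sum>k\<in>P. \<Prod>i\<in>UNIV. interval_coeff N (s i) (t i) (k i)
            * cis (2 * pi * real_of_int (int (k i) * (int j * int (p i))) / real N))"
      unfolding P_def PiE_UNIV_lessThan[symmetric] by (rule prod_sum_PiE) auto
    also have "\<dots> = (\<Sum>k\<in>P. C k * cis (2 * pi * real_of_int (int j * int (S k)) / real N))"
    proof (rule sum.cong[OF refl])
      fix k assume "k \<in> P"
      have cp: "(\<Prod>i\<in>A. cis (f i)) = cis (\<Sum>i\<in>A. f i)" if "finite A" for A :: "'n set" and f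
        using that by (induction rule: finite_induct) (auto simp: cis_mult)
      show "(\<Prod>i\<in>UNIV. interval_coeff N (s i) (t i) (k i)
            * cis (2 * pi * real_of_int (int (k i) * (int j * int (p i))) / real N))
          = C k * cis (2 * pi * real_of_int (int j * int (S k)) / real N)"
        by (simp add: prod.distrib C_def cp S_def sum_distrib_left sum_divide_distrib mult_ac)
    qed
    finally show ?thesis .
  qed
  have "complex_of_real (\<Sum>j=1..m. \<Prod>i\<in>UNIV. real (residue_count N (s i) (t i) (int j * int (p i))))
      = (\<Sum>j=1..m. \<Sum>k\<in>P. C k * cis (2 * pi * real_of_int (int j * int (S k)) / real N))"
    using expand by simp
  also have "\<dots> = (\<Sum>k\<in>P. C k * E k)"
    unfolding E_def sum_distrib_left by (rule sum.swap)
  also have "\<dots> = C (\<lambda>_. 0) * E (\<lambda>_. 0) + (\<Sum>k\<in>P'. C k * E k)"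
    using P by simp
  also have "C (\<lambda>_. 0) * E (\<lambda>_. 0)
      = complex_of_real (real m * (\<Prod>i\<in>UNIV. real_of_int (t i - s i) / real N))"
    by (simp only: C_def E_def S_def interval_coeff_0[OF st(1)]) simp
  finally have "complex_of_real ((\<Sum>j=1..m. \<Prod>i\<in>UNIV. real (residue_count N (s i) (t i) (int j * int (p i))))
      - real m * (\<Prod>i\<in>UNIV. real_of_int (t i - s i) / real N)) = (\<Sum>k\<in>P'. C k * E k)"
    by simp
  then have "\<bar>(\<Sum>j=1..m. \<Prod>i\<in>UNIV. real (residue_count N (s i) (t i) (int j * int (p i))))
      - real m * (\<Prod>i\<in>UNIV. real_of_int (t i - s i) / real N)\<bar> = norm (\<Sum>k\<in>P'. C k * E k)"
    by (simp only: norm_of_real[where ?'a = complex, symmetric])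
  also have "\<dots> \<le> (\<Sum>k\<in>P'. norm (C k) * norm (E k))"
    by (rule order_trans[OF norm_sum]) (simp add: norm_mult)
  also have "\<dots> \<le> resonance N p"
    unfolding resonance_def P'_def[symmetric] S_def[symmetric]
  proof (intro sum_mono mult_mono)
    fix k assume k: "k \<in> P'"
    show "norm (C k) \<le> (\<Prod>i\<in>UNIV. wt N (k i))"
      unfolding C_def prod_norm[symmetric]
      using k st by (intro prod_mono) (auto simp: P'_def intro: norm_interval_coeff_le)
    show "norm (E k) \<le> real N * wt N (S k mod N)"
    proof (cases "S k mod N = 0")
      \<comment> \<open>In resonance only the trivial bound \<open>m\<close> is available; it is
        covered by \<open>N * wt N 0 = 2 * N\<close>.\<close>
      case True
      have "norm (E k) \<le> (\<Sum>j=1..m. 1)"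
        unfolding E_def by (rule order_trans[OF norm_sum]) simp
      then show ?thesis using True m by (simp add: wt_def)
    next
      case False
      have "E k = (\<Sum>j\<in>{1..<int m + 1}. cis (2 * pi * real_of_int (j * int (S k)) / real N))"
        unfolding E_def
        by (rule sum.reindex_bij_witness[of _ nat int]) auto
      also have "norm \<dots> \<le> real N * wt N (nat (int (S k) mod int N))"
        using False N by (intro norm_sum_cis_le) (auto simp flip: of_nat_mod)
      finally show ?thesis by (simp flip: of_nat_mod)
    qed
  qed (auto intro!: prod_nonneg simp: wt_nonneg)
  finally show ?thesis .
qed

text \<open>Since \<open>N\<close> is prime, a nonzero coordinate of \<open>k\<close> is invertible,
  so \<open>k . p\<close> is equidistributed and the last weight has mean
  \<open>\<sigma> / N\<close>. What remains is a sum of products over the coordinates of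
  \<open>k\<close>.\<close>

lemma sum_resonance_le:
  fixes N :: nat
  assumes "prime N"
  shows "(\<Sum>p | \<forall>i. p i < N. resonance N (p :: 'n::finite \<Rightarrow> nat))
    \<le> real N ^ CARD('n) * (\<Sum>r<N. wt N r) ^ Suc CARD('n)"
proof -
  define P where "P = {k :: 'n \<Rightarrow> nat. \<forall>i. k i < N}"
  define P' where "P' = {k :: 'n \<Rightarrow> nat. (\<forall>i. k i < N) \<and> (\<exists>i. k i \<noteq> 0)}"
  define \<sigma> where "\<sigma> = (\<Sum>r<N. wt N r)"
  have N: "N > 0" using assms by (simp add: prime_gt_0_nat)
  have avg: "real N * (\<Sum>p\<in>P. wt N ((\<Sum>i\<in>UNIV. k i * p i) mod N)) = real N ^ CARD('n) * \<sigma>"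
    if k: "k \<in> P'" for k
  proof -
    obtain i0 where i0: "k i0 \<noteq> 0" "k i0 < N" using k by (auto simp: P'_def)
    have cop: "coprime (k i0) N"
      using i0 assms by (metis coprime_commute nat_dvd_not_less neq0_conv prime_imp_coprime)
    define S where "S p = (\<Sum>i\<in>UNIV. k i * p i)" for p :: "'n \<Rightarrow> nat"
    txt \<open>Averaging over translations of the coordinate \<open>i0\<close> makes the argument run through all
      residues.\<close>
    have shift: "(\<Sum>p\<in>P. wt N (S p mod N)) = (\<Sum>p\<in>P. wt N ((S p + k i0 * t) mod N))"
      if t: "t < N" for t
    proof (rule sum.reindex_bij_witness[symmetric, of _
          "\<lambda>p. p(i0 := (p i0 + (N - t)) mod N)" "\<lambda>p. p(i0 := (p i0 + t) mod N)"])
      fix p assume p: "p \<in> P"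
      then have lt: "p i0 < N" by (simp add: P_def)
      have cancel: "((p i0 + a) mod N + b) mod N = p i0" if "a + b = N" for a b
      proof -
        have "((p i0 + a) mod N + b) mod N = (p i0 + (a + b)) mod N"
          by (simp add: mod_add_left_eq add.assoc)
        then show ?thesis using that lt by simp
      qed
      show "(p(i0 := (p i0 + t) mod N)) (i0 := ((p(i0 := (p i0 + t) mod N)) i0 + (N - t)) mod N) = p"
        using cancel[of t "N - t"] t by (auto simp: fun_eq_iff)
      show "(p(i0 := (p i0 + (N - t)) mod N)) (i0 := ((p(i0 := (p i0 + (N - t)) mod N)) i0 + t) mod N) = p"
        using cancel[of "N - t" t] t by (auto simp: fun_eq_iff)
      show "p(i0 := (p i0 + t) mod N) \<in> P" "p(i0 := (p i0 + (N - t)) mod N) \<in> P"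
        using p N by (auto simp: P_def)
      have "S (p(i0 := (p i0 + t) mod N)) = k i0 * ((p i0 + t) mod N) + (\<Sum>i\<in>UNIV - {i0}. k i * p i)"
        unfolding S_def by (subst sum.remove[of _ i0]) auto
      moreover have "S p = k i0 * p i0 + (\<Sum>i\<in>UNIV - {i0}. k i * p i)"
        unfolding S_def by (subst sum.remove[of _ i0]) auto
      moreover have "(k i0 * ((p i0 + t) mod N) + c) mod N = (k i0 * p i0 + c + k i0 * t) mod N" for c
      proof -
        have "(k i0 * ((p i0 + t) mod N) + c) mod N = (k i0 * (p i0 + t) + c) mod N"
          by (rule mod_add_cong) (simp_all add: mod_mult_right_eq)
        then show ?thesis by (simp add: algebra_simps)
      qed
      ultimately show "wt N (S (p(i0 := (p i0 + t) mod N)) mod N) = wt N ((S p + k i0 * t) mod N)"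
        by simp
    qed
    have inner: "(\<Sum>t<N. wt N ((c + k i0 * t) mod N)) = \<sigma>" for c
    proof -
      have inj: "inj_on (\<lambda>t. (c + k i0 * t) mod N) {..<N}"
      proof (rule inj_onI)
        fix a b assume ab: "a \<in> {..<N}" "b \<in> {..<N}" "(c + k i0 * a) mod N = (c + k i0 * b) mod N"
        then have "[c + k i0 * a = c + k i0 * b] (mod N)" by (simp add: cong_def)
        then have "[k i0 * a = k i0 * b] (mod N)" by (simp add: cong_add_lcancel_nat)
        then have "[a = b] (mod N)" using cop by (simp add: cong_mult_lcancel_nat)
        then show "a = b" using ab by (simp add: cong_def)
      qed
      have "bij_betw (\<lambda>t. (c + k i0 * t) mod N) {..<N} {..<N}"
        unfolding bij_betw_def using inj N by (intro conjI endo_inj_surj) auto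
      then show ?thesis unfolding \<sigma>_def by (rule sum.reindex_bij_betw)
    qed
    have "real N * (\<Sum>p\<in>P. wt N (S p mod N)) = (\<Sum>t<N. \<Sum>p\<in>P. wt N (S p mod N))" by simp
    also have "\<dots> = (\<Sum>t<N. \<Sum>p\<in>P. wt N ((S p + k i0 * t) mod N))"
      by (rule sum.cong[OF refl]) (use shift in simp)
    also have "\<dots> = (\<Sum>p\<in>P. \<Sum>t<N. wt N ((S p + k i0 * t) mod N))"
      by (rule sum.swap)
    also have "\<dots> = real N ^ CARD('n) * \<sigma>"
      unfolding inner by (simp add: P_def card_bounded_funs)
    finally show ?thesis unfolding S_def .
  qed
  have "(\<Sum>p\<in>P. resonance N p)
      = (\<Sum>k\<in>P'. (\<Prod>i\<in>UNIV. wt N (k i)) * (real N * (\<Sum>p\<in>P. wt N ((\<Sum>i\<in>UNIV. k i * p i) mod N))))"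
    unfolding resonance_def P'_def[symmetric] sum_distrib_left by (rule sum.swap)
  also have "\<dots> = (\<Sum>k\<in>P'. (\<Prod>i\<in>UNIV. wt N (k i))) * (real N ^ CARD('n) * \<sigma>)"
    using avg by (simp add: sum_distrib_right)
  \<comment> \<open>Putting frequency 0 back makes the index set a full product, so that the sum
    factors.\<close>
  also have "\<dots> \<le> (\<Sum>k\<in>P. (\<Prod>i\<in>UNIV. wt N (k i))) * (real N ^ CARD('n) * \<sigma>)"
    by (intro mult_right_mono sum_mono2 prod_nonneg mult_nonneg_nonneg)
      (auto simp: P_def P'_def finite_bounded_funs wt_nonneg \<sigma>_def intro: sum_nonneg)
  also have "(\<Sum>k\<in>P. (\<Prod>i\<in>UNIV. wt N (k i))) = \<sigma> ^ CARD('n)"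
    unfolding P_def PiE_UNIV_lessThan[symmetric] \<sigma>_def by (subst prod_sum_PiE[symmetric]) auto
  finally show ?thesis unfolding P_def \<sigma>_def by (simp add: mult_ac)
qed

section \<open>Rounding to the grid\<close>

lemma residue_count_ge_1:
  assumes "z \<in> {s..<t}" "int N dvd q - z"
  shows "residue_count N s t q \<ge> 1"
proof -
  have "card {z} \<le> residue_count N s t q"
    unfolding residue_count_def by (rule card_mono) (use assms in \<open>auto intro: finite_subset[of _ "{s..<t}"]\<close>)
  then show ?thesis by simp
qed

lemma residue_count_le_1:
  assumes "t - s \<le> int N"
  shows "residue_count N s t q \<le> 1"
proof -
  have "z = z'" if z: "z \<in> {s..<t}" "z' \<in> {s..<t}" and d: "int N dvd q - z" "int N dvd q - z'" for z z'
  proof -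
    have "int N dvd z' - z" using dvd_diff[OF d] by simp
    moreover have "\<bar>z' - z\<bar> < int N" using z assms by auto
    ultimately show ?thesis using zdvd_not_zless[of "\<bar>z' - z\<bar>" "int N"] by fastforce
  qed
  then show ?thesis unfolding residue_count_def
    by (subst card_le_Suc0_iff_eq[unfolded One_nat_def[symmetric]]) (auto intro: finite_subset[of _ "{s..<t}"])
qed

text \<open>The factors are halved so that the telescoping bound for products of numbers of modulus
  at most 1 applies. The bound 2 leaves room for the enlarged sides.\<close>

lemma prod_diff_le:
  fixes x y :: "'n::finite \<Rightarrow> real"
  assumes "\<And>i. \<bar>x i\<bar> \<le> 2" "\<And>i. \<bar>y i\<bar> \<le> 2" "\<And>i. \<bar>x i - y i\<bar> \<le> e"
  shows "\<bar>(\<Prod>i\<in>UNIV. x i) - (\<Prod>i\<in>UNIV. y i)\<bar> \<le> 2 ^ CARD('n) * (real CARD('n) * e)"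
proof -
  have p: "(\<Prod>i\<in>UNIV. f i) = 2 ^ CARD('n) * (\<Prod>i\<in>UNIV. f i / 2)" for f :: "'n \<Rightarrow> real"
    by (simp add: prod_dividef)
  have "\<bar>(\<Prod>i\<in>UNIV. x i / 2) - (\<Prod>i\<in>UNIV. y i / 2)\<bar> \<le> (\<Sum>i\<in>UNIV. \<bar>x i / 2 - y i / 2\<bar>)"
    using norm_prod_diff[of "UNIV :: 'n set" "\<lambda>i. x i / 2" "\<lambda>i. y i / 2"] assms(1,2) by simp
  also have "\<dots> \<le> (\<Sum>i\<in>(UNIV :: 'n set). e)"
  proof (rule sum_mono)
    fix i show "\<bar>x i / 2 - y i / 2\<bar> \<le> e" using assms(3)[of i] by (simp add: abs_if split: if_splits)
  qed
  finally have "\<bar>(\<Prod>i\<in>UNIV. x i / 2) - (\<Prod>i\<in>UNIV. y i / 2)\<bar> \<le> real CARD('n) * e" by simp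
  then have "2 ^ CARD('n) * \<bar>(\<Prod>i\<in>UNIV. x i / 2) - (\<Prod>i\<in>UNIV. y i / 2)\<bar> \<le> 2 ^ CARD('n) * (real CARD('n) * e)"
    by (intro mult_left_mono) auto
  then show ?thesis
    by (simp add: p[of x] p[of y] abs_mult right_diff_distrib[symmetric] del: prod_dividef)
qed

text \<open>The rounding error \<open>N * y - p\<close> lies in [0, 1) and is multiplied by
  \<open>j \<le> m\<close>. The witness is not reduced modulo \<open>N\<close>: it may be negative
  when the fractional part is small.\<close>

lemma frac_mult_rounding:
  fixes N j :: nat and y :: real
  assumes N: "N > 0" and j: "1 \<le> j" "j \<le> m" and y: "0 \<le> y"
  defines "p \<equiv> nat \<lfloor>real N * y\<rfloor>"
  obtains z :: int where "int N dvd int j * int p - z"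
    "real_of_int z \<le> real N * frac (real j * y)" "real N * frac (real j * y) < real_of_int z + real m"
proof
  define z where "z = int j * int p - int N * \<lfloor>real j * y\<rfloor>"
  show "int N dvd int j * int p - z" by (simp add: z_def)
  have p: "real p \<le> real N * y" "real N * y < real p + 1"
    using y floor_correct[of "real N * y"] by (simp_all add: p_def)
  have e: "real N * frac (real j * y) - real_of_int z = real j * (real N * y - real p)"
    by (simp add: z_def frac_def algebra_simps)
  have "0 \<le> real j * (real N * y - real p)" using p by simp
  then show "real_of_int z \<le> real N * frac (real j * y)" using e by linarith
  have "real j * (real N * y - real p) < real j * 1"
    using p j by (intro mult_strict_left_mono) auto
  moreover have "real j \<le> real m" using j by simp
  ultimately show "real N * frac (real j * y) < real_of_int z + real m" using e by linarith
qed

text \<open>The count is squeezed between the counts of grid points in an enlarged and in a shrunk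
  window. Both windows have nearly the volume of the box, and the character estimate applies to
  each.\<close>

lemma box_discrepancy_le_resonance:
  fixes y a b :: "'n::finite \<Rightarrow> real" and m N :: nat
  assumes N: "m\<^sup>2 \<le> N" and m: "2 \<le> m"
    and y: "\<And>i. 0 \<le> y i" and ab: "\<And>i. 0 \<le> a i" "\<And>i. a i \<le> b i" "\<And>i. b i \<le> 1"
  shows "\<bar>real (card {j\<in>{1..m}. \<forall>i. a i \<le> frac (real j * y i) \<and> frac (real j * y i) < b i})
      - real m * (\<Prod>i\<in>UNIV. b i - a i)\<bar>
    \<le> resonance N (\<lambda>i. nat \<lfloor>real N * y i\<rfloor>) + 2 ^ CARD('n) * real CARD('n) * 2"
proof -
  define p where "p = (\<lambda>i. nat \<lfloor>real N * y i\<rfloor>)"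
  define J where "J = {j\<in>{1..m}. \<forall>i. a i \<le> frac (real j * y i) \<and> frac (real j * y i) < b i}"
  define \<eta> where "\<eta> = (real m + 2) / real N"
  have "2 * m \<le> m\<^sup>2" using m by (simp add: power2_eq_square)
  then have mN: "m + 2 \<le> N" using N m by linarith
  then have N0: "N > 0" by simp
  \<comment> \<open>Rounding changes each side by at most \<open>\<eta>\<close>; multiplied by
    \<open>m\<close>, this stays bounded because \<open>N\<close> is at least the square of
    \<open>m\<close>.\<close>
  have "m * m + 2 * m \<le> 2 * N" using N \<open>2 * m \<le> m\<^sup>2\<close> unfolding power2_eq_square by linarith
  then have "real m * (real m + 2) \<le> 2 * real N"
    by (metis (mono_tags, lifting) distrib_left mult.commute of_nat_add of_nat_le_iff of_nat_mult of_nat_numeral)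
  then have m\<eta>: "real m * \<eta> \<le> 2" using N0 by (simp add: \<eta>_def field_simps)
  have \<eta>1: "0 \<le> \<eta>" "\<eta> \<le> 1" using mN by (simp_all add: \<eta>_def)
  have N\<eta>: "real N * \<eta> = real m + 2" using N0 by (simp add: \<eta>_def)
  define K where "K = 2 ^ CARD('n) * (real CARD('n) * \<eta>)"
  have mK: "real m * K \<le> 2 ^ CARD('n) * real CARD('n) * 2"
    using mult_left_mono[OF m\<eta>, of "2 ^ CARD('n) * real CARD('n)"] by (simp add: K_def mult_ac)
  have ab1: "\<bar>b i - a i\<bar> \<le> 1" for i using ab[of i] by simp
  have real_card: "real (card J) = (\<Sum>j=1..m. if j \<in> J then 1 else 0)"
    by (simp add: J_def sum.If_cases Int_def)

  \<comment> \<open>The representative of \<open>j p\<close> lies less than \<open>m\<close> below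
    the true position, so the enlarged window is extended by \<open>m\<close> on the left
    only.\<close>
  define s where "s i = \<lceil>real N * a i\<rceil> - int m" for i
  define t where "t i = \<lceil>real N * b i\<rceil>" for i
  have Nab: "real N * a i \<le> real N * b i" "real N * b i \<le> real N" for i
    using ab by (auto intro: mult_left_mono mult_left_le)
  have st: "s i \<le> t i" "\<bar>real_of_int (t i - s i) - real N * (b i - a i)\<bar> \<le> real m + 2" for i
  proof -
    show "s i \<le> t i" using ceiling_mono[OF Nab(1)[of i]] by (simp add: s_def t_def)
    show "\<bar>real_of_int (t i - s i) - real N * (b i - a i)\<bar> \<le> real m + 2"
      unfolding s_def t_def right_diff_distrib by linarith
  qed
  have st2: "t i - s i \<le> 2 * int N" for i
  proof -
    have "real N * (b i - a i) \<le> real N" using ab1[of i] by (simp add: mult_left_le)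
    moreover have "real m + 2 \<le> real N" using mN by simp
    ultimately have "real_of_int (t i - s i) \<le> 2 * real N" using st(2)[of i] by linarith
    then show ?thesis by linarith
  qed
  have upper: "real (card J) \<le> (\<Sum>j=1..m. \<Prod>i\<in>UNIV. real (residue_count N (s i) (t i) (int j * int (p i))))"
    unfolding real_card
  proof (rule sum_mono)
    fix j assume j: "j \<in> {1..m}"
    show "(if j \<in> J then 1 else 0) \<le> (\<Prod>i\<in>UNIV. real (residue_count N (s i) (t i) (int j * int (p i))))"
    proof (cases "j \<in> J")
      case True
      have "1 \<le> residue_count N (s i) (t i) (int j * int (p i))" for i
      proof -
        obtain z where z: "int N dvd int j * int (p i) - z"
            "real_of_int z \<le> real N * frac (real j * y i)" "real N * frac (real j * y i) < real_of_int z + real m"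
          using frac_mult_rounding[OF N0, of j m "y i"] j y unfolding p_def by auto
        have "real N * a i \<le> real N * frac (real j * y i)" "real N * frac (real j * y i) < real N * b i"
          using True N0 by (auto simp: J_def)
        then have "s i \<le> z" "z < t i"
          using z unfolding s_def t_def by linarith+
        then show ?thesis using z by (intro residue_count_ge_1) auto
      qed
      then show ?thesis using True by (auto intro!: prod_ge_1 simp: Suc_le_eq)
    qed (auto intro: prod_nonneg)
  qed

  \<comment> \<open>The true position lies up to \<open>m\<close> above the grid point, so the
    shrunk window gives up \<open>m\<close> on the right. The maximum in \<open>t'\<close> makes it
    empty, not reversed, when the box is too thin.\<close>
  define s' where "s' i = \<lceil>real N * a i\<rceil>" for i
  define t' where "t' i = max (s' i) (\<lfloor>real N * b i\<rfloor> - int m)" for i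
  have st': "s' i \<le> t' i" "\<bar>real_of_int (t' i - s' i) - real N * (b i - a i)\<bar> \<le> real m + 2" for i
  proof -
    show "s' i \<le> t' i" by (simp add: t'_def)
    show "\<bar>real_of_int (t' i - s' i) - real N * (b i - a i)\<bar> \<le> real m + 2"
      using Nab(1)[of i] unfolding s'_def t'_def right_diff_distrib by linarith
  qed
  have st2': "t' i - s' i \<le> int N" for i
  proof -
    have "0 \<le> real N * a i" using ab by simp
    then show ?thesis using Nab(2)[of i] unfolding t'_def s'_def by linarith
  qed
  have lower: "(\<Sum>j=1..m. \<Prod>i\<in>UNIV. real (residue_count N (s' i) (t' i) (int j * int (p i)))) \<le> real (card J)"
    unfolding real_card
  proof (rule sum_mono)
    fix j assume j: "j \<in> {1..m}"
    show "(\<Prod>i\<in>UNIV. real (residue_count N (s' i) (t' i) (int j * int (p i)))) \<le> (if j \<in> J then 1 else 0)"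
    proof (cases "j \<in> J")
      case True
      then show ?thesis
        using residue_count_le_1[OF st2'] by (auto intro!: prod_le_1)
    next
      case False
      then obtain i where i: "\<not> (a i \<le> frac (real j * y i) \<and> frac (real j * y i) < b i)"
        using j by (auto simp: J_def)
      have "residue_count N (s' i) (t' i) (int j * int (p i)) = 0"
      proof (rule ccontr)
        assume "residue_count N (s' i) (t' i) (int j * int (p i)) \<noteq> 0"
        then have "{z \<in> {s' i..<t' i}. int N dvd int j * int (p i) - z} \<noteq> {}"
          unfolding residue_count_def by (metis card.empty)
        then obtain w where w: "s' i \<le> w" "w < t' i" "int N dvd int j * int (p i) - w" by auto
        obtain z where z: "int N dvd int j * int (p i) - z"
            "real_of_int z \<le> real N * frac (real j * y i)" "real N * frac (real j * y i) < real_of_int z + real m"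
          using frac_mult_rounding[OF N0, of j m "y i"] j y unfolding p_def by auto
        \<comment> \<open>The class of \<open>j p\<close> has two representatives here:
          \<open>w\<close> in the window and \<open>z\<close> near the true position. Adding the
          displacement \<open>v\<close> to \<open>w\<close> stays within [0, N), which forces
          \<open>w = z\<close>.\<close>
        define v where "v = real N * frac (real j * y i) - real_of_int z"
        have v: "0 \<le> v" "v < real m" using z by (auto simp: v_def)
        have w2: "real N * a i \<le> real_of_int w" "real_of_int w < real N * b i - real m"
          using w unfolding s'_def t'_def by linarith+
        have "0 \<le> real N * a i" using ab by simp
        obtain q where q: "w - z = int N * q"
          using dvd_diff[OF z(1) w(3)] by (auto simp: dvd_def)
        have "real_of_int w = real_of_int z + real N * real_of_int q"
          using q by (metis add_diff_cancel_left' diff_add_cancel add.commute of_int_add of_int_mult of_int_of_nat_eq)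
        then have wv: "real_of_int w + v = real N * (frac (real j * y i) + real_of_int q)"
          by (simp add: v_def algebra_simps)
        have "0 \<le> real_of_int w + v" using \<open>0 \<le> real N * a i\<close> w2 v by linarith
        moreover have "real_of_int w + v < real N" using w2 v Nab(2)[of i] by linarith
        ultimately have "0 \<le> frac (real j * y i) + real_of_int q" "frac (real j * y i) + real_of_int q < 1"
          unfolding wv using N0 by (auto simp: zero_le_mult_iff)
        then have "q = 0" using frac_ge_0[of "real j * y i"] frac_lt_1[of "real j * y i"] by linarith
        then have e: "real_of_int w + v = real N * frac (real j * y i)" using wv by simp
        have "real N * a i \<le> real N * frac (real j * y i)" "real N * frac (real j * y i) < real N * b i"
          using w2 v e by linarith+
        then show False using i N0 by simp
      qed
      then have "(\<Prod>i\<in>UNIV. real (residue_count N (s' i) (t' i) (int j * int (p i)))) = 0"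
        by (intro prod_zero) auto
      with False show ?thesis by (simp only: if_False order_refl)
    qed
  qed

  have vol: "\<bar>(\<Prod>i\<in>UNIV. real_of_int (T i - S i) / real N) - (\<Prod>i\<in>UNIV. b i - a i)\<bar> \<le> K"
    if ST: "\<And>i. \<bar>real_of_int (T i - S i) - real N * (b i - a i)\<bar> \<le> real m + 2" for S T :: "'n \<Rightarrow> int"
    unfolding K_def
  proof (rule prod_diff_le)
    fix i
    have "\<bar>real_of_int (T i - S i) / real N - (b i - a i)\<bar>
        = \<bar>real_of_int (T i - S i) - real N * (b i - a i)\<bar> / real N"
    proof -
      have "real_of_int (T i - S i) / real N - (b i - a i)
          = (real_of_int (T i - S i) - real N * (b i - a i)) / real N"
        using N0 by (simp add: field_simps)
      then show ?thesis by simp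
    qed
    also have "\<dots> \<le> \<eta>" unfolding \<eta>_def using ST by (intro divide_right_mono) auto
    finally show d: "\<bar>real_of_int (T i - S i) / real N - (b i - a i)\<bar> \<le> \<eta>" .
    then show "\<bar>real_of_int (T i - S i) / real N\<bar> \<le> 2" using \<eta>1 ab1[of i] by linarith
    show "\<bar>b i - a i\<bar> \<le> 2" using ab1[of i] by linarith
  qed
  have mN': "m \<le> 2 * N" using mN by simp
  define V where "V = (\<Prod>i\<in>UNIV. b i - a i)"
  have vol': "\<bar>real m * (\<Prod>i\<in>UNIV. real_of_int (T i - S i) / real N) - real m * V\<bar> \<le> 2 ^ CARD('n) * real CARD('n) * 2"
    if ST: "\<And>i. \<bar>real_of_int (T i - S i) - real N * (b i - a i)\<bar> \<le> real m + 2" for S T :: "'n \<Rightarrow> int"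
    using mult_left_mono[OF vol[OF ST, folded V_def], of "real m"] mK
    by (simp add: right_diff_distrib[symmetric] abs_mult)
  have st_weak: "t' i - s' i \<le> 2 * int N" for i using st2'[of i] by linarith
  show ?thesis
    using upper lower vol'[where S = s and T = t, OF st(2)] vol'[where S = s' and T = t', OF st'(2)]
      sum_residue_count_le_resonance[where p = p and s = s and t = t, OF N0 mN' st(1) st2]
      sum_residue_count_le_resonance[where p = p and s = s' and t = t', OF N0 mN' st'(1) st_weak]
    unfolding J_def[symmetric] p_def[symmetric] V_def[symmetric] by linarith
qed

section \<open>Boxes and cells in the torus\<close>

lift_definition torus_coord :: "'n::finite torus \<Rightarrow> 'n \<Rightarrow> real" is "\<lambda>u i. frac (u $ i)"
proof
  fix u v :: "real^'n" and i
  assume "int_lattice_rel u v"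
  then have "u $ i - v $ i \<in> \<int>" by (simp add: int_lattice_rel_def)
  then have "frac (v $ i + (u $ i - v $ i)) = frac (v $ i)" by (rule frac_add_int_right)
  then show "frac (u $ i) = frac (v $ i)" by simp
qed

lemma torus_coord_of: "torus_coord (torus_of u) i = frac (u $ i)"
  by transfer simp

lemma torus_coord_bounds: "0 \<le> torus_coord x i" "torus_coord x i < 1"
  using torus_of_surj[of x] by (auto simp: torus_coord_of frac_lt_1)

lemma torus_of_coord: "torus_of (\<chi> i. torus_coord x i) = x"
proof -
  obtain u where u: "torus_of u = x" using torus_of_surj by blast
  have "torus_of (\<chi> i. frac (u $ i)) = torus_of u"
    unfolding torus_of_eq_iff by (simp add: frac_def)
  with u show ?thesis by (auto simp: torus_coord_of)
qed

lemma torus_coord_mult: "torus_coord (torus_mult j x) i = frac (real j * torus_coord x i)"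
proof -
  have "torus_mult j x = torus_of (real j *\<^sub>R (\<chi> i. torus_coord x i))"
    by (metis torus_of_coord torus_mult_of)
  then show ?thesis by (simp add: torus_coord_of)
qed

text \<open>The coordinate jumps where it is 0, so its sublevel sets need not be open. The part with
  positive coordinate is open, as its preimage is a union of open strips; the slice at 0 is the
  complement of such an open set.\<close>

lemma borel_measurable_torus_coord [measurable]:
  "(\<lambda>x. torus_coord x i) \<in> borel_measurable (borel :: 'n::finite torus measure)"
  unfolding borel_measurable_iff_less
proof
  fix c :: real
  have op: "open {x :: 'n torus. 0 < torus_coord x i \<and> torus_coord x i < e}" for e
  proof -
    have "torus_of -` {x :: 'n torus. 0 < torus_coord x i \<and> torus_coord x i < e}
        = (\<Union>n::int. {u. of_int n < u $ i} \<inter> {u. u $ i < of_int n + min e 1})"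
    proof (intro equalityI subsetI)
      fix u :: "real^'n"
      assume "u \<in> torus_of -` {x. 0 < torus_coord x i \<and> torus_coord x i < e}"
      then have "of_int \<lfloor>u $ i\<rfloor> < u $ i" "u $ i < of_int \<lfloor>u $ i\<rfloor> + min e 1"
        using frac_lt_1[of "u $ i"] unfolding vimage_Collect_eq torus_coord_of mem_Collect_eq frac_def
        by linarith+
      then show "u \<in> (\<Union>n::int. {u. of_int n < u $ i} \<inter> {u. u $ i < of_int n + min e 1})" by blast
    next
      fix u :: "real^'n"
      assume "u \<in> (\<Union>n::int. {u. of_int n < u $ i} \<inter> {u. u $ i < of_int n + min e 1})"
      then obtain n :: int where n: "of_int n < u $ i" "u $ i < of_int n + min e 1" by auto
      then have "\<lfloor>u $ i\<rfloor> = n" by (simp add: floor_eq_iff)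
      then show "u \<in> torus_of -` {x. 0 < torus_coord x i \<and> torus_coord x i < e}"
        using n by (simp add: torus_coord_of frac_def)
    qed
    also have "open \<dots>"
      by (intro open_UN ballI open_Int open_Collect_less continuous_intros)
    finally show ?thesis unfolding open_torus_iff .
  qed
  have "{x :: 'n torus. torus_coord x i < c} = (if c \<le> 0 then {} else
      {x. 0 < torus_coord x i \<and> torus_coord x i < c} \<union> - {x. 0 < torus_coord x i \<and> torus_coord x i < 1})"
    by (auto simp: not_less torus_coord_bounds intro: order.trans[OF _ torus_coord_bounds(1)]
        dest: le_less_trans[OF torus_coord_bounds(1)])
  also have "\<dots> \<in> sets borel"
    using op by (auto intro!: borel_open sets.Un borel_comp)
  finally show "{w \<in> space borel. torus_coord (w :: 'n torus) i < c} \<in> sets borel" by simp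
qed

definition torus_box :: "('n::finite \<Rightarrow> real) \<Rightarrow> ('n \<Rightarrow> real) \<Rightarrow> 'n torus set" where
  "torus_box a b = {x. \<forall>i. a i \<le> torus_coord x i \<and> torus_coord x i < b i}"

lemma torus_box_borel [measurable]: "torus_box a b \<in> sets borel"
proof -
  have "torus_box a b = (\<Inter>i. {x. a i \<le> torus_coord x i} \<inter> {x. torus_coord x i < b i})"
    by (auto simp: torus_box_def)
  also have "\<dots> \<in> sets borel"
    by (intro sets.countable_INT' sets.Int) (auto simp: countable_finite)
  finally show ?thesis .
qed

lemma borel_subset_torus_measure: "A \<in> sets borel \<Longrightarrow> A \<in> sets torus_measure"
  by (simp add: torus_measure_def)

lemma emeasure_torus_measure_borel:
  assumes "A \<in> sets borel"
  shows "emeasure (torus_measure :: 'n::finite torus measure) A = emeasure lborel (torus_of -` A \<inter> unit_cell)"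
proof -
  have A: "A \<in> sets (distr (restrict_space lborel unit_cell) borel torus_of)" using assms by simp
  have "emeasure torus_measure A = emeasure (distr (restrict_space lborel unit_cell) borel torus_of) A"
    unfolding torus_measure_def using A by simp
  also have "\<dots> = emeasure (restrict_space lborel unit_cell) (torus_of -` A \<inter> unit_cell)"
    by (subst emeasure_distr[OF torus_of_measurable assms]) (simp add: space_restrict_space)
  also have "\<dots> = emeasure lborel (torus_of -` A \<inter> unit_cell)"
    by (rule emeasure_restrict_space) (auto simp: unit_cell_measurable)
  finally show ?thesis .
qed

lemma finite_measure_torus_measure: "finite_measure (torus_measure :: 'n::finite torus measure)"
  by (rule finite_measureI) (simp add: space_torus_measure emeasure_torus_measure_UNIV)

lemma measure_torus_measure_UNIV: "measure (torus_measure :: 'n::finite torus measure) UNIV = 1"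
  by (simp add: measure_def emeasure_torus_measure_UNIV)

lemma measure_torus_box:
  fixes a b :: "'n::finite \<Rightarrow> real"
  assumes ab: "\<And>i. 0 \<le> a i" "\<And>i. a i \<le> b i" "\<And>i. b i \<le> 1"
  shows "measure torus_measure (torus_box a b) = (\<Prod>i\<in>UNIV. b i - a i)"
proof -
  define A B where "A = (\<chi> i. a i)" and "B = (\<chi> i. b i)"
  define S where "S = torus_of -` torus_box a b \<inter> unit_cell"
  have S: "S = {u. \<forall>i. a i \<le> u $ i \<and> u $ i < b i}"
  proof (intro equalityI subsetI)
    fix u assume "u \<in> S"
    then show "u \<in> {u. \<forall>i. a i \<le> u $ i \<and> u $ i < b i}"
      by (auto simp: S_def unit_cell_def torus_box_def torus_coord_of)
  next
    fix u assume u: "u \<in> {u. \<forall>i. a i \<le> u $ i \<and> u $ i < b i}"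
    then have "0 \<le> u $ i \<and> u $ i < 1" for i
      using ab(1,3)[of i] by (auto intro: order_trans less_le_trans)
    then show "u \<in> S"
      using u by (auto simp: S_def unit_cell_def torus_box_def torus_coord_of)
  qed
  have eq: "emeasure lborel (box A B) = emeasure lborel (cbox A B)"
    by (simp add: emeasure_lborel_box_eq emeasure_lborel_cbox_eq)
  have sub: "box A B \<subseteq> S" "S \<subseteq> cbox A B"
    by (auto simp: S A_def B_def mem_box_cart less_imp_le)
  have "S \<in> sets lborel"
    unfolding S_def using measurable_sets[OF torus_of_measurable torus_box_borel[of a b]]
    by (simp add: space_restrict_space sets_restrict_space_iff unit_cell_measurable)
  then have "emeasure lborel S = emeasure lborel (cbox A B)"
    using emeasure_mono[OF sub(1), of lborel] emeasure_mono[OF sub(2), of lborel] eq by auto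
  then have "measure lborel S = measure lborel (cbox A B)" by (simp add: measure_def)
  also have "\<dots> = (\<Prod>i\<in>UNIV. b i - a i)"
    using ab by (subst content_cbox_cart) (auto simp: A_def B_def interval_ne_empty_cart)
  finally show ?thesis
    by (simp add: measure_def emeasure_torus_measure_borel S_def)
qed

section \<open>The grid of cubes of side \<open>1 / N\<close>\<close>

definition cell_index :: "nat \<Rightarrow> 'n::finite torus \<Rightarrow> 'n \<Rightarrow> nat" where
  "cell_index N x = (\<lambda>i. nat \<lfloor>real N * torus_coord x i\<rfloor>)"

definition torus_cell :: "nat \<Rightarrow> ('n::finite \<Rightarrow> nat) \<Rightarrow> 'n torus set" where
  "torus_cell N p = torus_box (\<lambda>i. real (p i) / real N) (\<lambda>i. real (p i + 1) / real N)"

lemma cell_index_less: "N > 0 \<Longrightarrow> cell_index N x i < N"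
proof -
  assume N: "N > 0"
  have "real N * torus_coord x i < real N" using N torus_coord_bounds[of x i] by simp
  moreover have "0 \<le> real N * torus_coord x i" by (simp add: torus_coord_bounds)
  ultimately show ?thesis using N unfolding cell_index_def by (simp add: nat_less_iff floor_less_iff)
qed

lemma mem_torus_cell_iff:
  assumes N: "N > 0"
  shows "x \<in> torus_cell N p \<longleftrightarrow> cell_index N x = p"
proof -
  have "real (p i) / real N \<le> torus_coord x i \<and> torus_coord x i < real (p i + 1) / real N
      \<longleftrightarrow> nat \<lfloor>real N * torus_coord x i\<rfloor> = p i" for i
  proof -
    have "0 \<le> real N * torus_coord x i" by (simp add: torus_coord_bounds)
    moreover have "real (p i) / real N \<le> torus_coord x i \<and> torus_coord x i < real (p i + 1) / real N
      \<longleftrightarrow> real (p i) \<le> real N * torus_coord x i \<and> real N * torus_coord x i < real (p i) + 1"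
      using N by (simp add: field_simps)
    ultimately show ?thesis by linarith
  qed
  then show ?thesis by (auto simp: torus_cell_def torus_box_def cell_index_def fun_eq_iff)
qed

lemma torus_cell_borel [measurable]: "torus_cell N p \<in> sets borel"
  by (simp add: torus_cell_def)

lemma measure_torus_cell:
  fixes p :: "'n::finite \<Rightarrow> nat"
  assumes "\<And>i. p i < N"
  shows "measure torus_measure (torus_cell N p) = 1 / real N ^ CARD('n)"
proof -
  have N: "N > 0" using assms[of undefined] by simp
  have "measure torus_measure (torus_cell N p) = (\<Prod>i\<in>(UNIV::'n set). real (p i + 1) / real N - real (p i) / real N)"
    unfolding torus_cell_def
  proof (rule measure_torus_box)
    fix i show "real (p i + 1) / real N \<le> 1" using N assms[of i] by (simp add: Suc_le_eq)
  qed (auto intro: divide_right_mono)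
  also have "\<dots> = (\<Prod>i\<in>(UNIV::'n set). 1 / real N)" by (simp add: diff_divide_distrib[symmetric])
  finally show ?thesis by (simp add: power_one_over)
qed

lemma Union_torus_cell_borel:
  fixes A :: "('n::finite \<Rightarrow> nat) set"
  shows "finite A \<Longrightarrow> (\<Union>p\<in>A. torus_cell N p) \<in> sets borel"
  by auto

lemma measure_Union_torus_cell:
  fixes A :: "('n::finite \<Rightarrow> nat) set"
  assumes "finite A" "\<And>p i. p \<in> A \<Longrightarrow> p i < N"
  shows "measure torus_measure (\<Union>p\<in>A. torus_cell N p) = real (card A) / real N ^ CARD('n)"
proof (cases "A = {}")
  case False
  then have N: "N > 0" using assms(2) by force
  interpret finite_measure "torus_measure :: 'n torus measure" by (rule finite_measure_torus_measure)
  have "measure torus_measure (\<Union>p\<in>A. torus_cell N p) = (\<Sum>p\<in>A. measure torus_measure (torus_cell N p))"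
    using assms N by (intro finite_measure_finite_Union)
      (auto simp: disjoint_family_on_def mem_torus_cell_iff borel_subset_torus_measure)
  also have "\<dots> = (\<Sum>p\<in>A. 1 / real N ^ CARD('n))"
    using assms by (intro sum.cong measure_torus_cell) auto
  finally show ?thesis by simp
qed simp

section \<open>Box discrepancy for almost every point\<close>

text \<open>The function is constant on the cells, which all have measure
  \<open>1 / N ^ CARD('n)\<close>, so Markov's inequality becomes a count of cells.\<close>

lemma markov_cell_index:
  fixes f :: "('n::finite \<Rightarrow> nat) \<Rightarrow> real"
  assumes N: "N > 0" and l: "l > 0" and f: "\<And>p. f p \<ge> 0"
  shows "{x :: 'n torus. f (cell_index N x) > l} \<in> sets borel"
    and "measure torus_measure {x :: 'n torus. f (cell_index N x) > l}
      \<le> (\<Sum>p | \<forall>i. p i < N. f p) / (l * real N ^ CARD('n))"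
proof -
  define P where "P = {p :: 'n \<Rightarrow> nat. \<forall>i. p i < N}"
  define A where "A = {p \<in> P. f p > l}"
  have finP: "finite P" unfolding P_def by (rule finite_bounded_funs)
  then have fin: "finite A" by (simp add: A_def)
  have eq: "{x :: 'n torus. f (cell_index N x) > l} = (\<Union>p\<in>A. torus_cell N p)"
    using N by (auto simp: mem_torus_cell_iff A_def P_def cell_index_less)
  show "{x :: 'n torus. f (cell_index N x) > l} \<in> sets borel"
    unfolding eq by (rule Union_torus_cell_borel[OF fin])
  have "measure torus_measure {x :: 'n torus. f (cell_index N x) > l} = real (card A) / real N ^ CARD('n)"
    unfolding eq by (rule measure_Union_torus_cell[OF fin]) (simp add: A_def P_def)
  also have "\<dots> \<le> ((\<Sum>p\<in>P. f p) / l) / real N ^ CARD('n)"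
  proof (rule divide_right_mono)
    have "l * real (card A) = (\<Sum>p\<in>A. l)" by simp
    also have "\<dots> \<le> (\<Sum>p\<in>A. f p)" by (rule sum_mono) (simp add: A_def)
    also have "\<dots> \<le> (\<Sum>p\<in>P. f p)" using finP f by (intro sum_mono2) (auto simp: A_def)
    finally show "real (card A) \<le> (\<Sum>p\<in>P. f p) / l" using l by (simp add: field_simps)
  qed simp
  finally show "measure torus_measure {x :: 'n torus. f (cell_index N x) > l}
      \<le> (\<Sum>p | \<forall>i. p i < N. f p) / (l * real N ^ CARD('n))"
    by (simp add: P_def mult.commute)
qed

lemma resonance_nonneg: "resonance N p \<ge> 0"
  unfolding resonance_def by (intro sum_nonneg mult_nonneg_nonneg prod_nonneg) (auto simp: wt_nonneg)

text \<open>Scale \<open>l\<close> is to serve all \<open>m \<le> 2 ^ 2 ^ (l + 1)\<close>, hence the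
  square. The logarithms grow like \<open>2 ^ l\<close>: the lower bound gives summability over
  \<open>l\<close>, the upper one the comparison with \<open>ln m\<close>.\<close>

lemma exists_prime_scales:
  obtains N :: "nat \<Rightarrow> nat"
  where "\<And>l. prime (N l)" "\<And>l. (2 ^ 2 ^ (l + 1))\<^sup>2 \<le> N l"
    "\<And>l. 2 ^ (l + 1) \<le> ln (real (N l))" "\<And>l. ln (real (N l)) \<le> 2 ^ (l + 4)"
proof -
  define n :: "nat \<Rightarrow> nat" where "n l = 2 ^ 2 ^ (l + 2)" for l
  have "\<exists>p. prime p \<and> n l < p \<and> p \<le> 2 * (n l)\<^sup>2" for l
  proof (rule exists_prime_le_square)
    have "(2::nat) ^ 1 \<le> 2 ^ (l + 2)" by (rule power_increasing) auto
    then have "(2::nat) ^ 2 \<le> 2 ^ 2 ^ (l + 2)" by (intro power_increasing) auto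
    then show "4 \<le> n l" by (simp add: n_def)
  qed
  then obtain N where N: "\<And>l. prime (N l)" "\<And>l. n l < N l" "\<And>l. N l \<le> 2 * (n l)\<^sup>2" by metis
  have lnn: "ln (real (n l)) = 2 ^ (l + 2) * ln 2" for l
    by (simp add: n_def ln_realpow)
  have ln2: "1 / 2 \<le> ln (2::real)" "ln (2::real) \<le> 1"
    using ln2_ge_two_thirds ln_2_less_1 by linarith+
  show thesis
  proof
    fix l
    show "prime (N l)" by (rule N)
    have "(2 ^ 2 ^ (l + 1))\<^sup>2 = n l"
      by (simp add: n_def power_mult[symmetric] mult.commute)
    then show "(2 ^ 2 ^ (l + 1))\<^sup>2 \<le> N l" using N(2)[of l] by simp
    have n0: "n l > 0" by (simp add: n_def)
    have "2 ^ (l + 1) = 2 ^ (l + 2) * (1 / 2 :: real)" by simp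
    also have "\<dots> \<le> ln (real (n l))" unfolding lnn using ln2 by (intro mult_left_mono) auto
    also have "\<dots> \<le> ln (real (N l))" using N(2)[of l] n0 by simp
    finally show "2 ^ (l + 1) \<le> ln (real (N l))" .
    have "real (N l) \<le> real (2 * (n l)\<^sup>2)" using N(3)[of l] by (simp only: of_nat_le_iff)
    then have "real (N l) \<le> 2 * (real (n l))\<^sup>2" by simp
    then have "ln (real (N l)) \<le> ln (2 * (real (n l))\<^sup>2)"
      using N(2)[of l] n0 by simp
    also have "\<dots> = ln 2 + 2 * (2 ^ (l + 2) * ln 2)"
      using n0 by (simp add: ln_mult ln_realpow lnn)
    also have "\<dots> \<le> 1 + 2 * (2 ^ (l + 2) * 1)"
      using ln2 by (intro add_mono mult_left_mono) auto
    also have "\<dots> \<le> 2 ^ (l + 4)"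
    proof -
      have "(1::real) \<le> 2 ^ (l + 2)" by (rule one_le_power) simp
      then show ?thesis by (simp add: power_add)
    qed
    finally show "ln (real (N l)) \<le> 2 ^ (l + 4)" .
  qed
qed

lemma AE_resonance_le:
  fixes \<epsilon> :: real and N :: "nat \<Rightarrow> nat"
  assumes \<epsilon>: "\<epsilon> > 0" and N: "\<And>l. prime (N l)" "\<And>l. 2 ^ (l + 1) \<le> ln (real (N l))"
  shows "AE x in (torus_measure :: 'n::finite torus measure). \<forall>\<^sub>F l in sequentially.
    resonance (N l) (cell_index (N l) x) \<le> ln (real (N l)) powr (real CARD('n) + 1 + \<epsilon>)"
proof -
  define \<Lambda> where "\<Lambda> l = ln (real (N l)) powr (real CARD('n) + 1 + \<epsilon>)" for l
  define B where "B l = {x :: 'n torus. resonance (N l) (cell_index (N l) x) > \<Lambda> l}" for l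
  \<comment> \<open>Mean over threshold is at most a constant times
    \<open>ln (N l) powr (- \<epsilon>)\<close>. As \<open>ln (N l) \<ge> 2 ^ l\<close>, this is
    dominated by a geometric series with ratio \<open>q < 1\<close>.\<close>
  define q where "q = 2 powr (- \<epsilon>)"
  interpret finite_measure "torus_measure :: 'n torus measure" by (rule finite_measure_torus_measure)
  have ln2: "2 \<le> ln (real (N l))" for l
    using N(2)[of l] order_trans[OF power_increasing[of 1 "l + 1" "2::real"]] by simp
  have N0: "N l > 0" for l using N(1) by (simp add: prime_gt_0_nat)
  have B: "B l \<in> sets borel" "measure torus_measure (B l) \<le> 4 ^ Suc CARD('n) * q ^ l" for l
  proof -
    have \<Lambda>: "\<Lambda> l > 0" using ln2[of l] by (simp add: \<Lambda>_def)
    show "B l \<in> sets borel"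
      unfolding B_def by (rule markov_cell_index(1)[OF N0 \<Lambda> resonance_nonneg])
    have "measure torus_measure (B l)
        \<le> (\<Sum>p | \<forall>i. p i < N l. resonance (N l) (p :: 'n \<Rightarrow> nat)) / (\<Lambda> l * real (N l) ^ CARD('n))"
      unfolding B_def by (rule markov_cell_index(2)[OF N0 \<Lambda> resonance_nonneg])
    also have "\<dots> \<le> (real (N l) ^ CARD('n) * (\<Sum>r<N l. wt (N l) r) ^ Suc CARD('n)) / (\<Lambda> l * real (N l) ^ CARD('n))"
      using \<Lambda> by (intro divide_right_mono sum_resonance_le[OF N(1)]) auto
    also have "\<dots> = (\<Sum>r<N l. wt (N l) r) ^ Suc CARD('n) / \<Lambda> l"
      using N0[of l] by simp
    also have "\<dots> \<le> (4 * ln (real (N l))) ^ Suc CARD('n) / \<Lambda> l"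
    proof (intro divide_right_mono power_mono sum_nonneg)
      have "(\<Sum>r<N l. wt (N l) r) \<le> 4 + 2 * ln (real (N l))"
        using N0[of l] by (intro sum_wt_le) simp
      then show "(\<Sum>r<N l. wt (N l) r) \<le> 4 * ln (real (N l))" using ln2[of l] by linarith
    qed (use \<Lambda> in \<open>auto simp: wt_nonneg\<close>)
    also have "\<dots> = 4 ^ Suc CARD('n) * (ln (real (N l)) powr (real (Suc CARD('n))) / \<Lambda> l)"
      using ln2[of l] by (subst powr_realpow) (auto simp: power_mult_distrib)
    also have "ln (real (N l)) powr (real (Suc CARD('n))) / \<Lambda> l = ln (real (N l)) powr (- \<epsilon>)"
      unfolding \<Lambda>_def powr_diff[symmetric] by simp
    also have "\<dots> \<le> (2 ^ l) powr (- \<epsilon>)"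
    proof -
      have "(2::real) ^ l \<le> 2 ^ (l + 1)" by simp
      then have "2 ^ l \<le> ln (real (N l))" using N(2)[of l] by linarith
      then show ?thesis using \<epsilon> by (intro powr_mono2') auto
    qed
    also have "(2 ^ l) powr (- \<epsilon>) = q ^ l"
    proof -
      have "q ^ l = 2 powr (- \<epsilon> * real l)"
        unfolding q_def by (simp add: powr_realpow[symmetric] powr_powr)
      also have "\<dots> = (2 powr real l) powr (- \<epsilon>)" by (simp add: powr_powr mult.commute)
      also have "\<dots> = (2 ^ l) powr (- \<epsilon>)" by (simp add: powr_realpow)
      finally show ?thesis by simp
    qed
    finally show "measure torus_measure (B l) \<le> 4 ^ Suc CARD('n) * q ^ l"
      by (simp add: mult_left_mono)
  qed
  have "q < 1" unfolding q_def using \<epsilon> powr_less_mono[of "- \<epsilon>" 0 2] by simp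
  moreover have "q > 0" by (simp add: q_def)
  ultimately have "summable (\<lambda>l. 4 ^ Suc CARD('n) * q ^ l)"
    by (intro summable_mult summable_geometric) simp
  then have sum: "summable (\<lambda>l. measure torus_measure (B l))"
    by (rule summable_comparison_test[rotated]) (use B(2) in \<open>simp del: power_Suc\<close>)
  have "AE x in torus_measure. \<forall>\<^sub>F l in sequentially. x \<in> space torus_measure - B l"
    by (rule borel_cantelli_AE1) (auto intro: borel_subset_torus_measure B(1) sum simp: emeasure_eq_measure)
  then show ?thesis
    by (elim AE_mp) (auto intro!: AE_I2 elim!: eventually_mono simp: B_def \<Lambda>_def not_less)
qed

theorem AE_torus_box_discrepancy:
  fixes \<epsilon> :: real
  assumes \<epsilon>: "\<epsilon> > 0"
  shows "AE x in (torus_measure :: 'n::finite torus measure). \<exists>C>0. \<forall>m>1. \<forall>a b.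
    (\<forall>i. 0 \<le> a i \<and> a i \<le> b i \<and> b i \<le> 1) \<longrightarrow>
    \<bar>real (card {j\<in>{1..m}. torus_mult j x \<in> torus_box a b}) - real m * (\<Prod>i\<in>UNIV. b i - a i)\<bar>
      \<le> C * ln (real m) powr (real CARD('n) + 1 + \<epsilon>)"
proof -
  define \<beta> where "\<beta> = real CARD('n) + 1 + \<epsilon>"
  have \<beta>: "\<beta> > 0" using \<epsilon> by (simp add: \<beta>_def)
  define D :: real where "D = 2 ^ CARD('n) * real CARD('n) * 2"
  obtain N :: "nat \<Rightarrow> nat" where N: "\<And>l. prime (N l)" "\<And>l. (2 ^ 2 ^ (l + 1))\<^sup>2 \<le> N l"
    "\<And>l. 2 ^ (l + 1) \<le> ln (real (N l))" "\<And>l. ln (real (N l)) \<le> 2 ^ (l + 4)"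
    by (rule exists_prime_scales) blast
  define X :: "nat \<Rightarrow> nat" where "X l = 2 ^ 2 ^ (l + 1)" for l
  have ln2: "1 / 2 \<le> ln (2::real)" using ln2_ge_two_thirds by linarith
  \<comment> \<open>Take the least \<open>l\<close> with \<open>m \<le> X l\<close>; that
    \<open>X (l - 1)\<close> is too small bounds \<open>2 ^ l\<close> by a multiple of
    \<open>ln m\<close>.\<close>
  have scale: "\<exists>l. m \<le> X l \<and> 2 ^ l \<le> 2 * ln (real m)" if m: "m > 1" for m
  proof -
    have ex: "m \<le> X m"
    proof -
      have "m < 2 ^ (m + 1)" using less_exp[of "m + 1"] by linarith
      also have "\<dots> < 2 ^ 2 ^ (m + 1)" by (rule less_exp)
      finally show ?thesis by (simp add: X_def)
    qed
    define l where "l = (LEAST l. m \<le> X l)"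
    have l: "m \<le> X l" unfolding l_def by (rule LeastI[where P = "\<lambda>l. m \<le> X l", OF ex])
    have lnm: "ln 2 \<le> ln (real m)" using m by simp
    show ?thesis
    proof (cases l)
      case 0
      then show ?thesis using l ln2 lnm by (intro exI[of _ 0]) auto
    next
      case (Suc l')
      then have "\<not> m \<le> X l'" using not_less_Least[of l' "\<lambda>l. m \<le> X l"] by (simp add: l_def)
      then have "2 ^ 2 ^ l \<le> m" using Suc by (simp add: X_def not_le)
      then have "real (2 ^ 2 ^ l) \<le> real m" by (simp only: of_nat_le_iff)
      then have "2 ^ 2 ^ l \<le> real m" by simp
      then have "ln (2 ^ 2 ^ l) \<le> ln (real m)" using m by (subst ln_le_cancel_iff) auto
      then have "2 ^ l * ln 2 \<le> ln (real m)" by (simp add: ln_realpow)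
      moreover have "2 ^ l * (1 / 2) \<le> 2 ^ l * ln (2::real)" using ln2 by (intro mult_left_mono) auto
      ultimately have "2 ^ l \<le> 2 * ln (real m)" by linarith
      with l show ?thesis by blast
    qed
  qed
  have key: "\<exists>C>0. \<forall>m>1. \<forall>a b. (\<forall>i. 0 \<le> a i \<and> a i \<le> b i \<and> b i \<le> 1) \<longrightarrow>
      \<bar>real (card {j\<in>{1..m}. torus_mult j x \<in> torus_box a b}) - real m * (\<Prod>i\<in>UNIV. b i - a i)\<bar>
      \<le> C * ln (real m) powr \<beta>"
    if ev: "\<forall>\<^sub>F l in sequentially. resonance (N l) (cell_index (N l) x) \<le> ln (real (N l)) powr \<beta>" for x :: "'n torus"
  proof -
    obtain l0 where l0: "\<And>l. l \<ge> l0 \<Longrightarrow> resonance (N l) (cell_index (N l) x) \<le> ln (real (N l)) powr \<beta>"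
      using ev unfolding eventually_sequentially by blast
    \<comment> \<open>The 32 is 16 from \<open>ln (N l) \<le> 2 ^ (l + 4)\<close> times 2 from the
      choice of scale. Additive constants are absorbed since \<open>2 * ln m \<ge> 1\<close>. The
      dependence on \<open>x\<close> is only through \<open>l0\<close>.\<close>
    define C where "C = 32 powr \<beta> + (D + real (X l0)) * 2 powr \<beta>"
    have "D \<ge> 0" by (simp add: D_def)
    then have "C > 0" by (auto simp: C_def intro!: add_pos_nonneg)
    moreover have "\<bar>real (card {j\<in>{1..m}. torus_mult j x \<in> torus_box a b}) - real m * (\<Prod>i\<in>UNIV. b i - a i)\<bar>
        \<le> C * ln (real m) powr \<beta>" (is "?disc \<le> _")
      if m: "m > 1" and ab: "\<forall>i. 0 \<le> a i \<and> a i \<le> b i \<and> b i \<le> 1" for m and a b :: "'n \<Rightarrow> real"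
    proof -
      have lnm: "ln 2 \<le> ln (real m)" using m by simp
      have one: "1 \<le> 2 powr \<beta> * ln (real m) powr \<beta>"
      proof -
        have "1 \<le> (2 * ln (real m)) powr \<beta>"
          using ln2 lnm \<beta> by (intro ge_one_powr_ge_zero) auto
        then show ?thesis using ln2 lnm by (simp add: powr_mult)
      qed
      obtain l where l: "m \<le> X l" "2 ^ l \<le> 2 * ln (real m)" using scale[OF m] by blast
      have "?disc \<le> 32 powr \<beta> * ln (real m) powr \<beta> + (D + real (X l0))"
      proof (cases "l \<ge> l0")
        case True
        have "m\<^sup>2 \<le> (X l)\<^sup>2" using l(1) by (rule power_mono) simp
        then have mN: "m\<^sup>2 \<le> N l"
          using N(2)[of l] unfolding X_def by (rule order_trans)
        have "?disc \<le> resonance (N l) (cell_index (N l) x) + D"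
          using box_discrepancy_le_resonance[OF mN, of "torus_coord x" a b] m ab
          by (simp add: torus_coord_bounds D_def cell_index_def torus_box_def torus_coord_mult)
        also have "\<dots> \<le> ln (real (N l)) powr \<beta> + D" using l0[OF True] by simp
        also have "ln (real (N l)) powr \<beta> \<le> (32 * ln (real m)) powr \<beta>"
        proof (rule powr_mono2)
          have "ln (real (N l)) \<le> 16 * 2 ^ l" using N(4)[of l] by (simp add: power_add)
          then show "ln (real (N l)) \<le> 32 * ln (real m)" using l(2) by linarith
          show "0 \<le> ln (real (N l))" using N(3)[of l] by (meson order_trans zero_le_power zero_le_numeral)
        qed (use \<beta> in simp)
        also have "(32 * ln (real m)) powr \<beta> = 32 powr \<beta> * ln (real m) powr \<beta>"
          using ln2 lnm by (simp add: powr_mult)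
        finally show ?thesis by simp
      next
        \<comment> \<open>Before \<open>l0\<close> the resonance is not controlled, but then
          \<open>m\<close> is bounded and the trivial bound by \<open>m\<close> suffices.\<close>
        case False
        have "X l \<le> X l0" using False unfolding X_def by (intro power_increasing) auto
        then have "m \<le> X l0" using l by simp
        have "card {j\<in>{1..m}. torus_mult j x \<in> torus_box a b} \<le> card {1..m}"
          by (rule card_mono) auto
        then have "real (card {j\<in>{1..m}. torus_mult j x \<in> torus_box a b}) \<le> real m" by simp
        moreover have "0 \<le> (\<Prod>i\<in>UNIV. b i - a i)" "(\<Prod>i\<in>UNIV. b i - a i) \<le> 1"
        proof -
          show "0 \<le> (\<Prod>i\<in>UNIV. b i - a i)" using ab by (intro prod_nonneg) auto
          show "(\<Prod>i\<in>UNIV. b i - a i) \<le> 1"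
          proof (intro prod_le_1 conjI)
            fix i show "0 \<le> b i - a i" "b i - a i \<le> 1" using ab[rule_format, of i] by auto
          qed
        qed
        then have "0 \<le> real m * (\<Prod>i\<in>UNIV. b i - a i)" "real m * (\<Prod>i\<in>UNIV. b i - a i) \<le> real m"
          by (auto simp: mult_left_le)
        ultimately have "?disc \<le> real m" by linarith
        also have "\<dots> \<le> real (X l0)" using \<open>m \<le> X l0\<close> by simp
        finally show ?thesis using \<open>D \<ge> 0\<close> by (simp add: add_increasing)
      qed
      also have "\<dots> \<le> 32 powr \<beta> * ln (real m) powr \<beta> + (D + real (X l0)) * (2 powr \<beta> * ln (real m) powr \<beta>)"
        using mult_left_mono[OF one, of "D + real (X l0)"] \<open>D \<ge> 0\<close> by simp
      also have "\<dots> = C * ln (real m) powr \<beta>" by (simp add: C_def algebra_simps)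
      finally show ?thesis .
    qed
    ultimately show ?thesis by blast
  qed
  show ?thesis
    using AE_resonance_le[OF \<epsilon> N(1,3), where 'n = 'n] unfolding \<beta>_def[symmetric]
    by (rule AE_mp) (intro AE_I2 impI, rule key)
qed

section \<open>From boxes to sets with controlled boundary\<close>

definition near_frontier :: "'n::finite torus set \<Rightarrow> real \<Rightarrow> 'n torus set" where
  "near_frontier \<Omega> t = {x. edist_set x (frontier \<Omega>) < ereal t}"

lemma near_frontier_alt: "near_frontier \<Omega> t = (\<Union>y\<in>frontier \<Omega>. ball y t)"
  by (auto simp: near_frontier_def edist_set_def INF_less_iff dist_commute)

text \<open>A non-measurable set would have \<^const>\<open>emeasure\<close> zero and make \<^const>\<open>boundary_content\<close>
  meaningless; the neighbourhoods are open, so this does not occur.\<close>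

lemma open_near_frontier: "open (near_frontier \<Omega> t)"
  unfolding near_frontier_alt by auto

lemma measure_near_frontier_le:
  fixes \<Omega> :: "'n::finite torus set"
  assumes c: "boundary_content \<alpha> \<Omega> < ennreal \<gamma>" and \<gamma>: "\<gamma> > 0" and t: "t > 0"
  shows "measure torus_measure (near_frontier \<Omega> t) \<le> \<gamma> * t powr \<alpha>"
proof -
  interpret finite_measure "torus_measure :: 'n torus measure" by (rule finite_measure_torus_measure)
  have "ennreal (t powr (- \<alpha>)) * emeasure torus_measure (near_frontier \<Omega> t) \<le> boundary_content \<alpha> \<Omega>"
    unfolding boundary_content_def near_frontier_def using t by (intro SUP_upper) auto
  then have "ennreal (t powr (- \<alpha>) * measure torus_measure (near_frontier \<Omega> t)) \<le> ennreal \<gamma>"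
    using c by (simp add: emeasure_eq_measure ennreal_mult)
  then have "t powr (- \<alpha>) * measure torus_measure (near_frontier \<Omega> t) \<le> \<gamma>"
    using \<gamma> by (simp add: ennreal_le_iff)
  then have "t powr \<alpha> * (t powr (- \<alpha>) * measure torus_measure (near_frontier \<Omega> t)) \<le> t powr \<alpha> * \<gamma>"
    by (intro mult_left_mono) auto
  moreover have "t powr \<alpha> * t powr (- \<alpha>) = 1"
    using t by (simp add: powr_add[symmetric])
  ultimately show ?thesis by (simp only: mult.assoc[symmetric] mult_1_left mult.commute[of \<gamma>])
qed

lemma torus_box_eq_image:
  assumes "\<And>i. 0 \<le> a i" "\<And>i. b i \<le> 1"
  shows "torus_box a b = torus_of ` {u. \<forall>i. a i \<le> u $ i \<and> u $ i < b i}"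
proof (intro equalityI subsetI)
  fix x assume "x \<in> torus_box a b"
  then have "(\<chi> i. torus_coord x i) \<in> {u. \<forall>i. a i \<le> u $ i \<and> u $ i < b i}"
    by (simp add: torus_box_def)
  then have "torus_of (\<chi> i. torus_coord x i) \<in> torus_of ` {u. \<forall>i. a i \<le> u $ i \<and> u $ i < b i}"
    by (rule imageI)
  then show "x \<in> torus_of ` {u. \<forall>i. a i \<le> u $ i \<and> u $ i < b i}"
    by (simp only: torus_of_coord)
next
  fix x assume "x \<in> torus_of ` {u. \<forall>i. a i \<le> u $ i \<and> u $ i < b i}"
  then obtain u where u: "x = torus_of u" "\<And>i. a i \<le> u $ i" "\<And>i. u $ i < b i" by blast
  have "frac (u $ i) = u $ i" for i
    using u(2,3)[of i] assms(1,2)[of i] by (simp add: frac_eq)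
  then show "x \<in> torus_box a b" using u by (simp add: torus_box_def torus_coord_of)
qed

text \<open>The box is the image of a convex set, hence connected, so it meets the boundary once it
  has points on both sides. Its diameter is at most \<open>CARD('n) * r\<close>, by comparison with
  the sum of the coordinate differences.\<close>

lemma torus_box_subset_near_frontier:
  fixes \<Omega> :: "'n::finite torus set"
  assumes ab: "\<And>i. 0 \<le> a i" "\<And>i. b i \<le> 1" and r: "\<And>i. b i - a i \<le> r"
    and t: "real CARD('n) * r < t"
    and y: "y \<in> torus_box a b" "y \<in> \<Omega>" and z: "z \<in> torus_box a b" "z \<notin> \<Omega>"
  shows "torus_box a b \<subseteq> near_frontier \<Omega> t"
proof
  fix x assume x: "x \<in> torus_box a b"
  define U where "U = {u :: real^'n. \<forall>i. a i \<le> u $ i \<and> u $ i < b i}"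
  have "convex U"
  proof -
    have "U = (\<Inter>i. {u. axis i 1 \<bullet> u \<ge> a i} \<inter> {u. axis i 1 \<bullet> u < b i})"
      by (auto simp: U_def inner_axis inner_commute[of "axis _ _"])
    also have "convex \<dots>"
      by (intro convex_INT convex_Int convex_halfspace_ge convex_halfspace_lt)
    finally show ?thesis .
  qed
  then have "connected (torus_of ` U)"
    by (intro connected_continuous_image continuous_on_torus_of convex_connected)
  moreover have img: "torus_box a b = torus_of ` U" unfolding U_def by (rule torus_box_eq_image[OF ab])
  ultimately have "torus_box a b \<inter> frontier \<Omega> \<noteq> {}"
    using y z by (intro connected_Int_frontier) auto
  then obtain w where w: "w \<in> torus_box a b" "w \<in> frontier \<Omega>" by blast
  obtain u v where uv: "u \<in> U" "v \<in> U" "x = torus_of u" "w = torus_of v"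
    using x w(1) unfolding img by blast
  have "dist w x \<le> dist v u" unfolding uv by (rule torus_dist_le)
  also have "\<dots> \<le> (\<Sum>i\<in>UNIV. \<bar>(v - u) $ i\<bar>)"
    unfolding dist_norm by (rule norm_le_l1_cart)
  also have "\<dots> \<le> (\<Sum>i\<in>(UNIV::'n set). r)"
  proof (rule sum_mono)
    fix i
    have "a i \<le> u $ i" "u $ i < b i" "a i \<le> v $ i" "v $ i < b i" using uv by (auto simp: U_def)
    then show "\<bar>(v - u) $ i\<bar> \<le> r"
      using r[of i] unfolding vector_minus_component by linarith
  qed
  also have "\<dots> < t" using t by simp
  finally have "x \<in> ball w t" by simp
  with w(2) show "x \<in> near_frontier \<Omega> t" unfolding near_frontier_alt by blast
qed

text \<open>The whole torus is a box of side 1. This later bounds \<open>\<gamma>\<close> from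
  below.\<close>

lemma near_frontier_UNIV:
  fixes \<Omega> :: "'n::finite torus set"
  assumes "frontier \<Omega> \<noteq> {}" and t: "real CARD('n) < t"
  shows "near_frontier \<Omega> t = UNIV"
proof -
  have "torus_box (\<lambda>_. 0) (\<lambda>_. 1) = (UNIV :: 'n torus set)"
    by (auto simp: torus_box_def torus_coord_bounds)
  moreover obtain y z where "y \<in> \<Omega>" "z \<notin> \<Omega>"
  proof -
    have "\<Omega> \<noteq> {}" "\<Omega> \<noteq> UNIV" using assms(1) by auto
    then show ?thesis using that by blast
  qed
  ultimately have "UNIV \<subseteq> near_frontier \<Omega> t"
    using torus_box_subset_near_frontier[of "\<lambda>_. 0" "\<lambda>_. 1" 1 t y \<Omega> z] t by simp
  then show ?thesis by blast
qed

text \<open>The distance to the empty set is infinite, so a set without boundary has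
  \<open>boundary_content\<close> 0 and \<open>\<gamma>\<close> may be arbitrarily small. Such sets
  must have no error at all; connectedness of the torus leaves only the two trivial ones.\<close>

lemma frontier_empty_torus:
  fixes \<Omega> :: "'n::finite torus set"
  assumes "frontier \<Omega> = {}"
  shows "\<Omega> = {} \<or> \<Omega> = UNIV"
proof -
  have "range torus_of = (UNIV :: 'n torus set)" using torus_of_surj by (metis surjI surj_def)
  then have "connected (UNIV :: 'n torus set)"
    by (metis connected_UNIV connected_continuous_image continuous_on_torus_of)
  from connected_Int_frontier[OF this, of \<Omega>] assms show ?thesis by auto
qed

text \<open>Summation by parts: 2 accounts for the end terms. For an indicator \<open>s\<close>, the
  remaining sum counts its changes.\<close>

lemma abel_sum_le:
  fixes s D :: "nat \<Rightarrow> real"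
  assumes s: "\<And>t. \<bar>s t\<bar> \<le> 1" and D: "\<And>t. t \<le> Suc k \<Longrightarrow> \<bar>D t\<bar> \<le> E"
  shows "\<bar>\<Sum>t<Suc k. s t * (D (Suc t) - D t)\<bar> \<le> E * (2 + (\<Sum>t<k. \<bar>s (Suc t) - s t\<bar>))"
proof -
  have eq: "(\<Sum>t<Suc k. s t * (D (Suc t) - D t))
      = s k * D (Suc k) - s 0 * D 0 - (\<Sum>t<k. (s (Suc t) - s t) * D (Suc t))"
    by (induction k) (simp_all add: algebra_simps)
  have b: "\<bar>s t * D t'\<bar> \<le> E" if "t' \<le> Suc k" for t t'
    using mult_mono[OF s[of t] D[OF that]] by (simp add: abs_mult)
  have "\<bar>\<Sum>t<k. (s (Suc t) - s t) * D (Suc t)\<bar> \<le> (\<Sum>t<k. \<bar>s (Suc t) - s t\<bar> * E)"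
    by (rule order_trans[OF sum_abs]) (auto intro!: sum_mono mult_left_mono D simp: abs_mult)
  then have "\<bar>\<Sum>t<k. (s (Suc t) - s t) * D (Suc t)\<bar> \<le> E * (\<Sum>t<k. \<bar>s (Suc t) - s t\<bar>)"
    by (simp only: sum_distrib_left mult.commute)
  then show ?thesis
    using b[of "Suc k" k] b[of 0 0] unfolding eq by (simp add: distrib_left)
qed

text \<open>Slices the grid into lines in direction \<open>i0\<close>, each represented by its point
  with coordinate 0.\<close>

lemma sum_bounded_funs_split:
  fixes g :: "('n::finite \<Rightarrow> nat) \<Rightarrow> 'a::comm_monoid_add"
  assumes K: "K > 0"
  shows "(\<Sum>p | \<forall>i. p i < K. g p) = (\<Sum>q | (\<forall>i. q i < K) \<and> q i0 = 0. \<Sum>t<K. g (q(i0 := t)))"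
proof -
  show ?thesis
    unfolding sum.cartesian_product
    by (rule sum.reindex_bij_witness[of _ "\<lambda>(q, t). q(i0 := t)" "\<lambda>p. (p(i0 := 0), p i0)"])
      (use K in \<open>auto simp: fun_eq_iff\<close>)
qed

lemma card_bounded_funs_0:
  assumes K: "K > 0"
  shows "real (card {q :: 'n::finite \<Rightarrow> nat. (\<forall>i. q i < K) \<and> q i0 = 0}) * real K = real K ^ CARD('n)"
  using sum_bounded_funs_split[OF K, of "\<lambda>_ :: 'n \<Rightarrow> nat. 1 :: real" i0]
  by (simp add: card_bounded_funs)

section \<open>Visits of the multiples of \<open>x\<close>, summed over the cubes\<close>

definition visits :: "nat \<Rightarrow> 'n::finite torus \<Rightarrow> 'n torus set \<Rightarrow> real" where
  "visits m x A = real (card {j\<in>{1..m}. torus_mult j x \<in> A})"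

lemma visits_Un: "A \<inter> B = {} \<Longrightarrow> visits m x (A \<union> B) = visits m x A + visits m x B"
proof -
  assume "A \<inter> B = {}"
  then have "card ({j\<in>{1..m}. torus_mult j x \<in> A} \<union> {j\<in>{1..m}. torus_mult j x \<in> B})
      = card {j\<in>{1..m}. torus_mult j x \<in> A} + card {j\<in>{1..m}. torus_mult j x \<in> B}"
    by (intro card_Un_disjoint) auto
  moreover have "{j\<in>{1..m}. torus_mult j x \<in> A \<union> B}
      = {j\<in>{1..m}. torus_mult j x \<in> A} \<union> {j\<in>{1..m}. torus_mult j x \<in> B}" by auto
  ultimately show ?thesis by (simp add: visits_def)
qed

lemma visits_UN:
  "finite I \<Longrightarrow> disjoint_family_on A I \<Longrightarrow> visits m x (\<Union>i\<in>I. A i) = (\<Sum>i\<in>I. visits m x (A i))"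
proof (induction I rule: finite_induct)
  case (insert i I)
  then have "A i \<inter> (\<Union>i\<in>I. A i) = {}" "disjoint_family_on A I"
    by (auto simp: disjoint_family_on_def)
  then show ?case using insert by (simp add: visits_Un)
qed (simp add: visits_def)

lemma visits_mono: "A \<subseteq> B \<Longrightarrow> visits m x A \<le> visits m x B"
  unfolding visits_def by (intro of_nat_mono card_mono) auto

lemma visits_UNIV: "visits m x UNIV = real m"
proof -
  have "{j \<in> {1..m}. torus_mult j x \<in> UNIV} = {1..m}" by auto
  then show ?thesis by (simp add: visits_def)
qed

text \<open>Only an upper bound is needed: the lower bound follows by passing to the complement, which
  has the same frontier.\<close>

lemma visits_upper_bound:
  fixes x :: "'n::finite torus" and \<Omega> :: "'n torus set"
  assumes disc: "\<And>a b. (\<And>i. 0 \<le> a i \<and> a i \<le> b i \<and> b i \<le> 1) \<Longrightarrow>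
      \<bar>visits m x (torus_box a b) - real m * (\<Prod>i\<in>UNIV. b i - a i)\<bar> \<le> E"
    and \<Omega>: "\<Omega> \<in> sets torus_measure" and K: "K > 0"
  shows "visits m x \<Omega> \<le> real m * measure torus_measure \<Omega>
    + (real m + E * real K ^ CARD('n)) * measure torus_measure (near_frontier \<Omega> (3 * real CARD('n) / real K))
    + 2 * E * real K ^ (CARD('n) - 1)"
proof -
  interpret finite_measure "torus_measure :: 'n torus measure" by (rule finite_measure_torus_measure)
  define P where "P = {p :: 'n \<Rightarrow> nat. \<forall>i. p i < K}"
  \<comment> \<open>Two adjacent cubes form a box with sides at most \<open>2 / K\<close>; 3 in
    place of 2 gives the strict inequality \<open>rt\<close>.\<close>
  define t where "t = 3 * real CARD('n) / real K"
  define A where "A = {p \<in> P. torus_cell K p \<inter> \<Omega> \<noteq> {}}"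
  define A' where "A' = {p \<in> P. torus_cell K p \<subseteq> \<Omega>}"
  define S where "S = {p \<in> P. torus_cell K p \<subseteq> near_frontier \<Omega> t}"
  have finP: "finite P" unfolding P_def by (rule finite_bounded_funs)
  then have fin: "finite A" "finite A'" "finite S" by (auto simp: A_def A'_def S_def)
  have d: "real CARD('n) \<ge> 1" by (simp add: Suc_le_eq)
  have rt: "real CARD('n) * (2 / real K) < t" using K d by (simp add: t_def divide_strict_right_mono)
  have E: "E \<ge> 0" using disc[of "\<lambda>_. 0" "\<lambda>_. 0"] by (meson abs_ge_zero order_refl order_trans zero_le_one)
  have Pcell: "p i + 1 \<le> K" if "p \<in> P" for p i using that by (auto simp: P_def Suc_le_eq)
  have S_mu: "real (card S) \<le> real K ^ CARD('n) * measure torus_measure (near_frontier \<Omega> t)"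
  proof -
    have "real (card S) / real K ^ CARD('n) = measure torus_measure (\<Union>p\<in>S. torus_cell K p)"
      using fin by (intro measure_Union_torus_cell[symmetric]) (auto simp: S_def P_def)
    also have "\<dots> \<le> measure torus_measure (near_frontier \<Omega> t)"
      using fin by (intro finite_measure_mono borel_subset_torus_measure borel_open open_near_frontier)
        (auto simp: S_def)
    finally show ?thesis using K by (simp add: field_simps)
  qed
  have A'_mu: "real (card A') \<le> real K ^ CARD('n) * measure torus_measure \<Omega>"
  proof -
    have "real (card A') / real K ^ CARD('n) = measure torus_measure (\<Union>p\<in>A'. torus_cell K p)"
      using fin by (intro measure_Union_torus_cell[symmetric]) (auto simp: A'_def P_def)
    also have "\<dots> \<le> measure torus_measure \<Omega>"
      using \<Omega> by (intro finite_measure_mono) (auto simp: A'_def)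
    finally show ?thesis using K by (simp add: field_simps)
  qed
  \<comment> \<open>The cubes in \<open>A\<close> cover \<open>\<Omega>\<close>, those in
    \<open>A'\<close> lie inside it, and a cube of the first kind that is not of the second has
    points on both sides and so lies near the boundary.\<close>
  have "A \<subseteq> A' \<union> S"
  proof
    fix p assume p: "p \<in> A"
    show "p \<in> A' \<union> S"
    proof (cases "torus_cell K p \<subseteq> \<Omega>")
      case True
      then show ?thesis using p by (auto simp: A_def A'_def)
    next
      case False
      then obtain y z where yz: "y \<in> torus_cell K p" "y \<in> \<Omega>" "z \<in> torus_cell K p" "z \<notin> \<Omega>"
        using p by (auto simp: A_def)
      have "torus_cell K p \<subseteq> near_frontier \<Omega> t"
        unfolding torus_cell_def
      proof (rule torus_box_subset_near_frontier[OF _ _ _ rt])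
        fix i
        show "real (p i + 1) / real K \<le> 1" using p K Pcell[of p i] by (simp add: A_def)
        show "real (p i + 1) / real K - real (p i) / real K \<le> 2 / real K"
          using K by (simp add: diff_divide_distrib[symmetric] divide_right_mono)
      qed (use yz in \<open>auto simp: torus_cell_def\<close>)
      then show ?thesis using p by (simp add: A_def S_def)
    qed
  qed
  then have "card A \<le> card A' + card S"
    using fin by (meson card_Un_le card_mono finite_UnI order_trans)
  then have A_card: "real (card A) \<le> real (card A') + real (card S)" by linarith

  obtain i0 :: 'n where "True" by simp
  define P0 where "P0 = {q :: 'n \<Rightarrow> nat. (\<forall>i. q i < K) \<and> q i0 = 0}"
  define s where "s p = (if p \<in> A then 1 else 0 :: real)" for p
  \<comment> \<open>The first \<open>k\<close> cubes of the line through \<open>q\<close> form one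
    box, with discrepancy \<open>D q k\<close>. The discrepancy of a single cube is thus a
    difference of consecutive values of \<open>D\<close>, ready for summation by parts.\<close>
  define hi where "hi q k = (\<lambda>i. if i = i0 then real k / real K else real (q i + 1) / real K)" for q :: "'n \<Rightarrow> nat" and k :: nat
  define lo where "lo q = (\<lambda>i. if i = i0 then 0 else real (q i) / real K)" for q :: "'n \<Rightarrow> nat"
  define V where "V k = real k / real K ^ CARD('n)" for k :: nat
  define D where "D q k = visits m x (torus_box (lo q) (hi q k)) - real m * V k" for q k
  have D_le: "\<bar>D q k\<bar> \<le> E" if q: "q \<in> P0" and k: "k \<le> K" for q k
  proof -
    have "(\<Prod>i\<in>UNIV. hi q k i - lo q i) = (real k / real K) * (\<Prod>i\<in>UNIV - {i0}. 1 / real K)"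
      by (subst prod.remove[of _ i0])
        (auto simp: hi_def lo_def diff_divide_distrib[symmetric] intro!: arg_cong2[of _ _ _ _ "(*)"] prod.cong)
    also have "\<dots> = real k / (real K * real K ^ (CARD('n) - 1))"
      by (simp add: card_Diff_singleton power_one_over)
    also have "real K * real K ^ (CARD('n) - 1) = real K ^ CARD('n)"
      by (simp add: power_eq_if[of _ "CARD('n)"])
    finally have vol: "(\<Prod>i\<in>UNIV. hi q k i - lo q i) = V k" by (simp add: V_def)
    have "0 \<le> lo q i \<and> lo q i \<le> hi q k i \<and> hi q k i \<le> 1" for i
    proof -
      have "q i < K" using q by (simp add: P0_def)
      then show ?thesis using k K by (simp add: lo_def hi_def divide_right_mono)
    qed
    then show ?thesis unfolding D_def vol[symmetric] by (rule disc)
  qed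
  have all_split: "(\<forall>i. Q i) \<longleftrightarrow> (\<forall>i. i \<noteq> i0 \<longrightarrow> Q i) \<and> Q i0" for Q :: "'n \<Rightarrow> bool"
    by metis
  define W where "W q y \<longleftrightarrow> (\<forall>i. i \<noteq> i0 \<longrightarrow>
      real (q i) / real K \<le> torus_coord y i \<and> torus_coord y i < real (q i + 1) / real K)"
    for q :: "'n \<Rightarrow> nat" and y
  have mem_box: "y \<in> torus_box (lo q) (hi q k) \<longleftrightarrow> W q y \<and> torus_coord y i0 < real k / real K" for q k y
    unfolding torus_box_def mem_Collect_eq W_def
    by (subst all_split) (simp add: hi_def lo_def torus_coord_bounds)
  have mem_cell: "y \<in> torus_cell K (q(i0 := k)) \<longleftrightarrow>
      W q y \<and> real k / real K \<le> torus_coord y i0 \<and> torus_coord y i0 < real (Suc k) / real K" for q k y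
    unfolding torus_cell_def torus_box_def mem_Collect_eq W_def
    by (subst all_split) simp
  have mid: "real k / real K \<le> real (Suc k) / real K" for k by (simp add: divide_right_mono)
  have D_diff: "D q (Suc k) - D q k = visits m x (torus_cell K (q(i0 := k))) - real m / real K ^ CARD('n)" for q k
  proof -
    have "torus_box (lo q) (hi q (Suc k)) = torus_box (lo q) (hi q k) \<union> torus_cell K (q(i0 := k))"
      unfolding set_eq_iff Un_iff mem_box mem_cell using mid[of k]
      by (metis less_le_trans not_le)
    moreover have "torus_box (lo q) (hi q k) \<inter> torus_cell K (q(i0 := k)) = {}"
      unfolding set_eq_iff Int_iff mem_box mem_cell by (auto simp: not_le[symmetric])
    ultimately have "visits m x (torus_box (lo q) (hi q (Suc k)))
        = visits m x (torus_box (lo q) (hi q k)) + visits m x (torus_cell K (q(i0 := k)))"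
      by (simp add: visits_Un)
    then show ?thesis by (simp add: D_def V_def add_divide_distrib distrib_left)
  qed
  have change: "\<bar>s (q(i0 := Suc k)) - s (q(i0 := k))\<bar> \<le> (if q(i0 := k) \<in> S then 1 else 0)"
    if q: "q \<in> P0" and k: "Suc k < K" for q k
  proof (cases "q(i0 := Suc k) \<in> A \<longleftrightarrow> q(i0 := k) \<in> A")
    \<comment> \<open>Exactly one of two neighbouring cubes meets \<open>\<Omega>\<close>; the other
      lies wholly outside. Their union is a box with points on both sides, so it lies near the
      boundary, and the change is charged to the first cube.\<close>
    case False
    define a where "a i = real ((q(i0 := k)) i) / real K" for i
    define b where "b i = (if i = i0 then real (k + 2) / real K else real (q i + 1) / real K)" for i
    have inP: "q(i0 := Suc k) \<in> P" "q(i0 := k) \<in> P" using q k by (auto simp: P0_def P_def)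
    \<comment> \<open>Positive measure shows that the cube avoiding \<open>\<Omega>\<close> does
      supply a point outside.\<close>
    have ne: "torus_cell K p \<noteq> {}" if "p \<in> P" for p
      using measure_torus_cell[of p K] that K by (auto simp: P_def)
    have mem_ab: "y \<in> torus_box a b \<longleftrightarrow>
        W q y \<and> real k / real K \<le> torus_coord y i0 \<and> torus_coord y i0 < real (Suc (Suc k)) / real K" for y
      unfolding torus_box_def mem_Collect_eq W_def
      by (subst all_split) (simp add: a_def b_def)
    have sub: "torus_cell K (q(i0 := Suc k)) \<subseteq> torus_box a b" "torus_cell K (q(i0 := k)) \<subseteq> torus_box a b"
      unfolding subset_iff mem_ab mem_cell using mid[of k] mid[of "Suc k"]
      by (blast intro: order_trans less_le_trans)+
    obtain y where y: "y \<in> torus_box a b" "y \<in> \<Omega>"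
      using False sub inP by (auto simp: A_def)
    obtain z where z: "z \<in> torus_box a b" "z \<notin> \<Omega>"
      using False sub inP ne by (auto simp: A_def) blast+
    have "torus_box a b \<subseteq> near_frontier \<Omega> t"
    proof (rule torus_box_subset_near_frontier[OF _ _ _ rt y z])
      fix i
      have "q i < K" using q by (simp add: P0_def)
      then show "b i \<le> 1" using k by (simp add: b_def)
      show "b i - a i \<le> 2 / real K"
        using K by (simp add: a_def b_def diff_divide_distrib[symmetric] divide_right_mono)
    qed (simp add: a_def)
    then show ?thesis using sub inP by (auto simp: S_def s_def)
  qed (auto simp: s_def)
  have line: "\<bar>\<Sum>k<K. s (q(i0 := k)) * (visits m x (torus_cell K (q(i0 := k))) - real m / real K ^ CARD('n))\<bar>
      \<le> E * (2 + (\<Sum>k<K. if q(i0 := k) \<in> S then 1 else 0))" if q: "q \<in> P0" for q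
  proof -
    obtain k where k: "K = Suc k" using K by (cases K) auto
    have "\<bar>\<Sum>l<Suc k. s (q(i0 := l)) * (D q (Suc l) - D q l)\<bar>
        \<le> E * (2 + (\<Sum>l<k. \<bar>s (q(i0 := Suc l)) - s (q(i0 := l))\<bar>))"
      by (rule abel_sum_le) (use D_le[OF q] k in \<open>auto simp: s_def\<close>)
    also have "\<dots> \<le> E * (2 + (\<Sum>l<k. if q(i0 := l) \<in> S then 1 else 0))"
      using E k by (intro mult_left_mono add_left_mono sum_mono change[OF q]) auto
    also have "\<dots> \<le> E * (2 + (\<Sum>l<K. if q(i0 := l) \<in> S then 1 else 0))"
      using E k by (intro mult_left_mono add_left_mono sum_mono2) auto
    finally show ?thesis unfolding D_diff k .
  qed
  \<comment> \<open>Each of the \<open>K ^ (CARD('n) - 1)\<close> lines costs \<open>2 * E\<close>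
    for its ends. The changes on all lines together cost at most \<open>E * card S\<close>, since
    distinct changes are charged to distinct cubes.\<close>
  have "(\<Sum>p\<in>P. s p * (visits m x (torus_cell K p) - real m / real K ^ CARD('n)))
      = (\<Sum>q\<in>P0. \<Sum>k<K. s (q(i0 := k)) * (visits m x (torus_cell K (q(i0 := k))) - real m / real K ^ CARD('n)))"
    unfolding P_def P0_def by (rule sum_bounded_funs_split[OF K])
  also have "\<dots> \<le> (\<Sum>q\<in>P0. E * (2 + (\<Sum>k<K. if q(i0 := k) \<in> S then 1 else 0)))"
    by (intro sum_mono) (use line in \<open>auto dest: abs_le_D1\<close>)
  also have "\<dots> = E * (2 * real (card P0) + (\<Sum>q\<in>P0. \<Sum>k<K. if q(i0 := k) \<in> S then 1 else 0))"
    by (simp add: sum_distrib_left[symmetric] sum.distrib mult.commute)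
  also have "(\<Sum>q\<in>P0. \<Sum>k<K. if q(i0 := k) \<in> S then 1 else 0) = (\<Sum>p\<in>P. if p \<in> S then 1 else 0 :: real)"
    unfolding P_def P0_def by (rule sum_bounded_funs_split[OF K, symmetric])
  also have "\<dots> = real (card S)"
  proof -
    have "{p \<in> P. p \<in> S} = S" by (auto simp: S_def)
    then show ?thesis using finP by (simp add: sum.If_cases Int_def)
  qed
  also have "real (card P0) = real K ^ (CARD('n) - 1)"
  proof -
    have "real (card P0) * real K = real K ^ CARD('n)"
      unfolding P0_def by (rule card_bounded_funs_0[OF K])
    also have "\<dots> = real K ^ (CARD('n) - 1) * real K"
      by (simp add: power_eq_if[of _ "CARD('n)"])
    finally show ?thesis using K by simp
  qed
  finally have main: "(\<Sum>p\<in>P. s p * (visits m x (torus_cell K p) - real m / real K ^ CARD('n)))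
      \<le> E * (2 * real K ^ (CARD('n) - 1) + real (card S))" .
  have "visits m x \<Omega> \<le> visits m x (\<Union>p\<in>A. torus_cell K p)"
  proof (rule visits_mono, rule subsetI)
    fix y assume "y \<in> \<Omega>"
    then have "cell_index K y \<in> A" "y \<in> torus_cell K (cell_index K y)"
      using K by (auto simp: A_def P_def cell_index_less mem_torus_cell_iff)
    then show "y \<in> (\<Union>p\<in>A. torus_cell K p)" by blast
  qed
  also have "\<dots> = (\<Sum>p\<in>A. visits m x (torus_cell K p))"
    using fin K by (intro visits_UN) (auto simp: disjoint_family_on_def mem_torus_cell_iff)
  also have "\<dots> = (\<Sum>p\<in>A. visits m x (torus_cell K p) - real m / real K ^ CARD('n))
      + real m * (real (card A) / real K ^ CARD('n))"
    by (simp add: sum_subtractf)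
  also have "(\<Sum>p\<in>A. visits m x (torus_cell K p) - real m / real K ^ CARD('n))
      = (\<Sum>p\<in>P. s p * (visits m x (torus_cell K p) - real m / real K ^ CARD('n)))"
    using finP by (intro sum.mono_neutral_cong_left) (auto simp: A_def s_def)
  finally have 1: "visits m x \<Omega> \<le> E * (2 * real K ^ (CARD('n) - 1) + real (card S))
      + real m * (real (card A) / real K ^ CARD('n))"
    using main by linarith
  have "real (card A) / real K ^ CARD('n) \<le> measure torus_measure \<Omega> + measure torus_measure (near_frontier \<Omega> t)"
  proof -
    have "real (card A) \<le> real K ^ CARD('n) * (measure torus_measure \<Omega> + measure torus_measure (near_frontier \<Omega> t))"
      using A_card A'_mu S_mu by (simp add: distrib_left)
    then show ?thesis using K by (simp add: field_simps)
  qed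
  then have 2: "real m * (real (card A) / real K ^ CARD('n))
      \<le> real m * (measure torus_measure \<Omega> + measure torus_measure (near_frontier \<Omega> t))"
    by (rule mult_left_mono) simp
  have 3: "E * real (card S) \<le> E * (real K ^ CARD('n) * measure torus_measure (near_frontier \<Omega> t))"
    using S_mu E by (rule mult_left_mono)
  show ?thesis using 1 2 3 unfolding t_def[symmetric] by (simp add: algebra_simps)
qed

text \<open>Sets without boundary are exact, and for \<open>m < E\<close> the trivial bound 1
  suffices. Otherwise the mesh is chosen so that the discrepancies of all
  \<open>K ^ CARD('n)\<close> cubes together amount to at most \<open>m\<close>.\<close>

lemma visits_upper_bound_boundary_content:
  fixes x :: "'n::finite torus" and \<Omega> :: "'n torus set"
  assumes disc: "\<And>a b. (\<And>i. 0 \<le> a i \<and> a i \<le> b i \<and> b i \<le> 1) \<Longrightarrow>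
      \<bar>visits m x (torus_box a b) - real m * (\<Prod>i\<in>UNIV. b i - a i)\<bar> \<le> E"
    and \<Omega>: "\<Omega> \<in> sets torus_measure" and c: "boundary_content \<alpha> \<Omega> < ennreal \<gamma>"
    and \<alpha>: "0 \<le> \<alpha>" "\<alpha> \<le> 1" and \<gamma>: "\<gamma> > 0" and m: "m > 0" and E: "E > 0"
  shows "visits m x \<Omega> / real m - measure torus_measure \<Omega>
    \<le> 20 * real CARD('n) * \<gamma> * (E / real m) powr (\<alpha> / real CARD('n))"
proof -
  interpret finite_measure "torus_measure :: 'n torus measure" by (rule finite_measure_torus_measure)
  define d where "d = real CARD('n)"
  have d: "d \<ge> 1" by (simp add: d_def Suc_le_eq)
  have powr_le: "s powr \<alpha> \<le> s" if "s \<ge> 1" for s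
    using powr_mono[OF \<alpha>(2) that] that by simp
  show ?thesis
  proof (cases "frontier \<Omega> = {}")
    case True
    then consider "\<Omega> = {}" | "\<Omega> = UNIV" using frontier_empty_torus by blast
    then have "visits m x \<Omega> / real m - measure torus_measure \<Omega> = 0"
      using m by cases (simp_all add: visits_UNIV measure_torus_measure_UNIV, simp add: visits_def)
    then show ?thesis using \<gamma> by simp
  next
    case False
    \<comment> \<open>A nonempty boundary has the whole torus as its neighbourhood of radius
      \<open>2 * d\<close>, so \<open>\<gamma>\<close> cannot be small. This lets error terms free
      of \<open>\<gamma>\<close> be bounded by multiples of it.\<close>
    have \<gamma>_ge: "1 \<le> 2 * d * \<gamma>"
    proof -
      have "measure torus_measure (near_frontier \<Omega> (2 * d)) \<le> \<gamma> * (2 * d) powr \<alpha>"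
        using d by (intro measure_near_frontier_le[OF c \<gamma>]) simp
      also have "near_frontier \<Omega> (2 * d) = UNIV"
        using d by (intro near_frontier_UNIV[OF False]) (simp add: d_def)
      also have "\<gamma> * (2 * d) powr \<alpha> \<le> \<gamma> * (2 * d)"
        using d \<gamma> by (intro mult_left_mono powr_le) auto
      finally show ?thesis by (simp add: measure_torus_measure_UNIV mult_ac)
    qed
    show ?thesis
    proof (cases "real m < E")
      case True
      have "visits m x \<Omega> \<le> real m" using visits_mono[of \<Omega> UNIV m x] by (simp add: visits_UNIV)
      then have "visits m x \<Omega> / real m \<le> 1" using m by (simp add: field_simps)
      then have "visits m x \<Omega> / real m - measure torus_measure \<Omega> \<le> 1 * 1"
        using measure_nonneg[of torus_measure \<Omega>] by linarith
      also have "\<dots> \<le> (20 * d * \<gamma>) * (E / real m) powr (\<alpha> / d)"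
      proof (rule mult_mono)
        show "1 \<le> (E / real m) powr (\<alpha> / d)"
          using True m \<alpha> d by (intro ge_one_powr_ge_zero) auto
        show "1 \<le> 20 * d * \<gamma>" using \<gamma>_ge by linarith
      qed (use \<gamma> d in auto)
      finally show ?thesis by (simp add: d_def)
    next
      case mE: False
      \<comment> \<open>This balances \<open>m\<close> against \<open>E * K ^ CARD('n)\<close>.
        Rounding down keeps the latter at most \<open>m\<close> and, because
        \<open>r \<ge> 1\<close>, loses at most a factor 2.\<close>
      define r where "r = (real m / E) powr (1 / d)"
      have r1: "r \<ge> 1" unfolding r_def using mE E d by (intro ge_one_powr_ge_zero) auto
      define K where "K = nat \<lfloor>r\<rfloor>"
      have K: "K > 0" "real K \<le> r" "r / 2 \<le> real K"
      proof -
        have "1 \<le> \<lfloor>r\<rfloor>" using r1 by linarith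
        then have "real K = of_int \<lfloor>r\<rfloor>" "K > 0" by (auto simp: K_def)
        with r1 show "K > 0" "real K \<le> r" "r / 2 \<le> real K" by linarith+
      qed
      have rd: "r ^ CARD('n) = real m / E"
      proof -
        have "r ^ CARD('n) = r powr d" using r1 by (simp add: d_def powr_realpow)
        also have "\<dots> = real m / E" unfolding r_def using d E m by (simp add: powr_powr)
        finally show ?thesis .
      qed
      have Kd: "E * real K ^ CARD('n) \<le> real m"
      proof -
        have "real K ^ CARD('n) \<le> r ^ CARD('n)" using K by (intro power_mono) auto
        then show ?thesis unfolding rd using E by (simp add: field_simps)
      qed
      define Q where "Q = real K powr (- \<alpha>)"
      have Q0: "Q > 0" using K by (simp add: Q_def)
      have KQ: "1 / real K \<le> Q"
      proof -
        have "1 / real K = real K powr (- 1)" using K by (simp add: powr_neg_one)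
        also have "\<dots> \<le> Q" unfolding Q_def using K \<alpha> by (intro powr_mono) auto
        finally show ?thesis .
      qed
      have Q_le: "Q \<le> 2 * (E / real m) powr (\<alpha> / d)"
      proof -
        have "Q \<le> (r / 2) powr (- \<alpha>)" unfolding Q_def using K r1 \<alpha> by (intro powr_mono2') auto
        also have "\<dots> = 2 powr \<alpha> * r powr (- \<alpha>)"
          using r1 by (simp add: powr_divide powr_minus field_simps)
        also have "r powr (- \<alpha>) = (E / real m) powr (\<alpha> / d)"
          unfolding r_def using m E by (simp add: powr_powr powr_minus powr_divide field_simps)
        also have "2 powr \<alpha> * (E / real m) powr (\<alpha> / d) \<le> 2 * (E / real m) powr (\<alpha> / d)"
          by (intro mult_right_mono powr_le) auto
        finally show ?thesis .
      qed
      have near: "measure torus_measure (near_frontier \<Omega> (3 * d / real K)) \<le> 3 * d * \<gamma> * Q"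
      proof -
        have "measure torus_measure (near_frontier \<Omega> (3 * d / real K)) \<le> \<gamma> * (3 * d / real K) powr \<alpha>"
          using d K by (intro measure_near_frontier_le[OF c \<gamma>]) simp
        also have "(3 * d / real K) powr \<alpha> = (3 * d) powr \<alpha> * Q"
        proof -
          have "(3 * d / real K) powr \<alpha> = (3 * d) powr \<alpha> / real K powr \<alpha>"
            by (rule powr_divide)
          then show ?thesis by (simp only: Q_def powr_minus divide_inverse)
        qed
        also have "\<gamma> * ((3 * d) powr \<alpha> * Q) \<le> \<gamma> * (3 * d * Q)"
          using d \<gamma> Q0 by (intro mult_left_mono mult_right_mono powr_le) auto
        finally show ?thesis by (simp add: mult_ac)
      qed
      \<comment> \<open>The ends of the lines cost a factor \<open>1 / K\<close> less than the
        cubes, and \<open>1 / K \<le> Q\<close> because \<open>\<alpha> \<le> 1\<close>; the factor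
        \<open>\<gamma>\<close> comes from \<open>\<gamma>_ge\<close>.\<close>
      have lines: "2 * E * real K ^ (CARD('n) - 1) \<le> real m * (4 * d * \<gamma> * Q)"
      proof -
        have "real K ^ CARD('n) = real K * real K ^ (CARD('n) - 1)"
          by (simp add: power_eq_if[of _ "CARD('n)"])
        then have "2 * E * real K ^ (CARD('n) - 1) = 2 * (E * real K ^ CARD('n)) * (1 / real K)"
          using K by simp
        also have "\<dots> \<le> 2 * real m * Q"
          using Kd KQ K E by (intro mult_mono) auto
        also have "\<dots> \<le> 2 * real m * (Q * (2 * d * \<gamma>))"
          using \<gamma>_ge Q0 by (intro mult_left_mono) (auto simp: mult_le_cancel_left1)
        finally show ?thesis by (simp add: mult_ac)
      qed
      have "visits m x \<Omega> \<le> real m * measure torus_measure \<Omega>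
          + (real m + E * real K ^ CARD('n)) * measure torus_measure (near_frontier \<Omega> (3 * d / real K))
          + 2 * E * real K ^ (CARD('n) - 1)"
        unfolding d_def by (rule visits_upper_bound[OF disc \<Omega> K(1)])
      also have "(real m + E * real K ^ CARD('n)) * measure torus_measure (near_frontier \<Omega> (3 * d / real K))
          \<le> (2 * real m) * (3 * d * \<gamma> * Q)"
        using Kd near E by (intro mult_mono) auto
      \<comment> \<open>The 10 is 6 from the neighbourhood and 4 from the ends of the lines;
        \<open>Q_le\<close> doubles it to 20.\<close>
      finally have "visits m x \<Omega> \<le> real m * (measure torus_measure \<Omega> + 10 * d * \<gamma> * Q)"
        using lines by (simp add: algebra_simps)
      then have "visits m x \<Omega> / real m - measure torus_measure \<Omega> \<le> 10 * d * \<gamma> * Q"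
        using m by (simp add: field_simps)
      also have "\<dots> \<le> 10 * d * \<gamma> * (2 * (E / real m) powr (\<alpha> / d))"
        using Q_le d \<gamma> by (intro mult_left_mono) auto
      finally show ?thesis by (simp add: d_def)
    qed
  qed
qed

lemma abs_visits_diff_le:
  fixes x :: "'n::finite torus" and \<Omega> :: "'n torus set"
  assumes disc: "\<And>a b. (\<And>i. 0 \<le> a i \<and> a i \<le> b i \<and> b i \<le> 1) \<Longrightarrow>
      \<bar>visits m x (torus_box a b) - real m * (\<Prod>i\<in>UNIV. b i - a i)\<bar> \<le> E"
    and \<Omega>: "\<Omega> \<in> sets torus_measure" and c: "boundary_content \<alpha> \<Omega> < ennreal \<gamma>"
    and \<alpha>: "0 \<le> \<alpha>" "\<alpha> \<le> 1" and \<gamma>: "\<gamma> > 0" and m: "m > 0" and E: "E > 0"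
  shows "\<bar>measure torus_measure \<Omega> - visits m x \<Omega> / real m\<bar>
    \<le> 20 * real CARD('n) * \<gamma> * (E / real m) powr (\<alpha> / real CARD('n))"
proof -
  interpret finite_measure "torus_measure :: 'n torus measure" by (rule finite_measure_torus_measure)
  have compl: "- \<Omega> \<in> sets torus_measure"
    using sets.compl_sets[OF \<Omega>] by (simp add: space_torus_measure Compl_eq_Diff_UNIV)
  have c': "boundary_content \<alpha> (- \<Omega>) < ennreal \<gamma>"
    using c by (simp add: boundary_content_def frontier_complement)
  have "visits m x (\<Omega> \<union> - \<Omega>) = visits m x \<Omega> + visits m x (- \<Omega>)" by (rule visits_Un) simp
  then have "visits m x (- \<Omega>) / real m = 1 - visits m x \<Omega> / real m"
    using m by (simp add: visits_UNIV field_simps)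
  moreover have "measure torus_measure (- \<Omega>) = 1 - measure torus_measure \<Omega>"
    using finite_measure_compl[OF \<Omega>]
    by (simp add: space_torus_measure Compl_eq_Diff_UNIV measure_torus_measure_UNIV)
  ultimately show ?thesis
    using visits_upper_bound_boundary_content[OF disc \<Omega> c \<alpha> \<gamma> m E]
      visits_upper_bound_boundary_content[OF disc compl c' \<alpha> \<gamma> m E]
    by (simp add: abs_le_iff)
qed

theorem theorem3:
  fixes \<alpha> \<epsilon> :: real
  assumes "0 \<le> \<alpha>" and "\<alpha> \<le> 1" and "\<epsilon> > 0"
  shows "AE x in (torus_measure :: 'n::finite torus measure).
    \<exists>c::real. \<forall>m::nat. \<forall>\<gamma>::real. m > 1 \<longrightarrow> \<gamma> > 0 \<longrightarrow>
      (SUP \<Omega> \<in> {\<Omega> \<in> sets torus_measure. boundary_content \<alpha> \<Omega> < ennreal \<gamma>}.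
         ereal \<bar>measure torus_measure \<Omega>
                 - (\<Sum>j=1..m. indicat_real \<Omega> (torus_mult j x)) / real m\<bar>)
      \<le> ereal (c * \<gamma> * real m powr (- \<alpha> / real CARD('n))
               * ln (real m) powr (\<alpha> * (real CARD('n) + 1 + \<epsilon>) / real CARD('n)))"
  using AE_torus_box_discrepancy[OF assms(3), where 'n = 'n]
proof (rule AE_mp, intro AE_I2 impI)
  fix x :: "'n torus"
  define d where "d = real CARD('n)"
  define \<beta> where "\<beta> = d + 1 + \<epsilon>"
  assume "\<exists>C>0. \<forall>m>1. \<forall>a b. (\<forall>i. 0 \<le> a i \<and> a i \<le> b i \<and> b i \<le> 1) \<longrightarrow>
    \<bar>real (card {j\<in>{1..m}. torus_mult j x \<in> torus_box a b}) - real m * (\<Prod>i\<in>UNIV. b i - a i)\<bar>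
      \<le> C * ln (real m) powr (real CARD('n) + 1 + \<epsilon>)"
  then obtain C where C: "C > 0" and disc: "\<And>m a b. m > 1 \<Longrightarrow> (\<And>i. 0 \<le> a i \<and> a i \<le> b i \<and> b i \<le> 1) \<Longrightarrow>
    \<bar>visits m x (torus_box a b) - real m * (\<Prod>i\<in>UNIV. b i - a i)\<bar> \<le> C * ln (real m) powr \<beta>"
    unfolding visits_def \<beta>_def d_def by blast
  show "\<exists>c::real. \<forall>m::nat. \<forall>\<gamma>::real. m > 1 \<longrightarrow> \<gamma> > 0 \<longrightarrow>
      (SUP \<Omega> \<in> {\<Omega> \<in> sets torus_measure. boundary_content \<alpha> \<Omega> < ennreal \<gamma>}.
         ereal \<bar>measure torus_measure \<Omega>
                 - (\<Sum>j=1..m. indicat_real \<Omega> (torus_mult j x)) / real m\<bar>)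
      \<le> ereal (c * \<gamma> * real m powr (- \<alpha> / real CARD('n))
               * ln (real m) powr (\<alpha> * (real CARD('n) + 1 + \<epsilon>) / real CARD('n)))"
    unfolding d_def[symmetric] \<beta>_def[symmetric]
  proof (intro exI allI impI SUP_least)
    fix m \<gamma> and \<Omega> :: "'n torus set"
    assume m: "m > (1::nat)" and \<gamma>: "\<gamma> > (0::real)"
      and \<Omega>: "\<Omega> \<in> {\<Omega> \<in> sets torus_measure. boundary_content \<alpha> \<Omega> < ennreal \<gamma>}"
    define E where "E = C * ln (real m) powr \<beta>"
    have lnm: "ln (real m) > 0" using m by simp
    then have E: "E > 0" using C by (simp add: E_def)
    have "(\<Sum>j=1..m. indicat_real \<Omega> (torus_mult j x)) = visits m x \<Omega>"
      by (simp add: visits_def indicator_def sum.If_cases Int_def)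
    moreover have "\<bar>measure torus_measure \<Omega> - visits m x \<Omega> / real m\<bar>
        \<le> 20 * d * \<gamma> * (E / real m) powr (\<alpha> / d)"
      unfolding d_def using \<Omega> m \<gamma> E assms
      by (intro abs_visits_diff_le) (auto intro: disc[OF m, folded E_def])
    moreover have "(E / real m) powr (\<alpha> / d)
        = C powr (\<alpha> / d) * real m powr (- \<alpha> / d) * ln (real m) powr (\<alpha> * \<beta> / d)"
    proof -
      have "(E / real m) powr (\<alpha> / d) = E powr (\<alpha> / d) / real m powr (\<alpha> / d)"
        by (rule powr_divide)
      also have "\<dots> = E powr (\<alpha> / d) * real m powr (- \<alpha> / d)"
        by (simp only: minus_divide_left[symmetric] powr_minus divide_inverse[of "_ powr _"])
      also have "E powr (\<alpha> / d) = C powr (\<alpha> / d) * ln (real m) powr (\<alpha> * \<beta> / d)"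
        unfolding E_def using C lnm by (simp add: powr_mult powr_powr mult.commute)
      finally show ?thesis by (simp add: mult_ac)
    qed
    \<comment> \<open>Only here is the constant \<open>c\<close> fixed, as
      \<open>20 * d * C powr (\<alpha> / d)\<close>: it depends on \<open>x\<close> through
      \<open>C\<close>, and not on \<open>m\<close>, \<open>\<gamma>\<close> or
      \<open>\<Omega>\<close>.\<close>
    ultimately show "ereal \<bar>measure torus_measure \<Omega> - (\<Sum>j=1..m. indicat_real \<Omega> (torus_mult j x)) / real m\<bar>
        \<le> ereal (20 * d * C powr (\<alpha> / d) * \<gamma> * real m powr (- \<alpha> / d) * ln (real m) powr (\<alpha> * \<beta> / d))"
      by (simp add: mult_ac)
  qed
qed

end
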